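(* Let $G$ be a finite abelian group, and let $r>q\geq 0$ and $m\geq |G|$ be integers with $\exp(G)\mid m$. Then $$(r-q)m+\max(q,D(G)-1)\leq R(S(r,q,m),G)\leq (r-q)m+\min\big((r-q)(D(G)-1),|G|-1\big)+q.$$
   Context: $\exp(G)$ is the exponent of $G$. $D(G)$ (the Davenport constant) is the smallest positive integer $d$ such that every sequence of $d$ elements of $G$ has a nonempty subsequence with sum $0$. A collection of $m$ distinct $r$-sets $e_1,\dots,e_m$ is a delta-system of type $S(r,q,m)$ if there is a set $Q$ with $|Q|=q<r$ such that $e_i\cap e_j=Q$ for all $1\le i<j\le m$. $K_d^{(r)}$ is the complete $r$-uniform hypergraph on $d$ vertices, and a $G$-coloring of it is any map $c$ from its edge set to $G$. $R(S(r,q,m),G)$ is the smallest positive integer $d$ such that for every $G$-coloring $c$ of $K_d^{(r)}$ there is a delta-system $e_1,\dots,e_m$ of type $S(r,q,m)$ consisting of edges of $K_d^{(r)}$ with $\sum_{i=1}^m c(e_i)=0$. *)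

theory Defs
  imports Complex_Main
begin

text \<open>A finite abelian group \<open>G\<close> is a type \<open>'g :: {ab_group_add, finite}\<close>; invariants of \<open>G\<close> take
  the argument \<open>TYPE('g)\<close>. The \<open>n\<close>-fold multiple of \<open>g\<close> is written \<open>\<Sum>i<n. g\<close>.\<close>

definition group_exponent :: "'g :: {ab_group_add, finite} itself \<Rightarrow> nat" where
  "group_exponent _ = (LEAST n. 0 < n \<and> (\<forall>g :: 'g. (\<Sum>i<n. g) = 0))"

definition davenport :: "'g :: {ab_group_add, finite} itself \<Rightarrow> nat" where
  "davenport _ = (LEAST d. 0 < d \<and>
     (\<forall>s :: nat \<Rightarrow> 'g. \<exists>I \<subseteq> {..<d}. I \<noteq> {} \<and> (\<Sum>i\<in>I. s i) = 0))"

definition delta_system :: "nat \<Rightarrow> nat \<Rightarrow> nat \<Rightarrow> (nat \<Rightarrow> 'v set) \<Rightarrow> bool" where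
  "delta_system r q m e \<longleftrightarrow> q < r \<and>
     inj_on e {1..m} \<and> (\<forall>i\<in>{1..m}. finite (e i) \<and> card (e i) = r) \<and>
     (\<exists>Q. finite Q \<and> card Q = q \<and> (\<forall>i j. 1 \<le> i \<and> i < j \<and> j \<le> m \<longrightarrow> e i \<inter> e j = Q))"

definition complete_edges :: "nat \<Rightarrow> nat \<Rightarrow> nat set set" where
  "complete_edges r d = {e. e \<subseteq> {..<d} \<and> card e = r}"

text \<open>A colouring is a total function on sets of vertices; only its values on
  \<open>complete_edges r d\<close> matter.\<close>

definition delta_ramsey :: "nat \<Rightarrow> nat \<Rightarrow> nat \<Rightarrow> 'g :: {ab_group_add, finite} itself \<Rightarrow> nat" where
  "delta_ramsey r q m _ = (LEAST d. 0 < d \<and>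
     (\<forall>c :: nat set \<Rightarrow> 'g. \<exists>e. delta_system r q m e \<and>
        (\<forall>i\<in>{1..m}. e i \<in> complete_edges r d) \<and> (\<Sum>i=1..m. c (e i)) = 0))"

text \<open>The minima above are taken over nonempty sets.\<close>

lemma multiple_add: "(\<Sum>i<a + (b :: nat). g) = (\<Sum>i<a. g) + (\<Sum>i<b. (g :: 'g :: ab_group_add))"
  by (induction b) (simp_all add: add.assoc)

lemma multiple_zero_dvd:
  assumes "(\<Sum>i<n. (g :: 'g :: ab_group_add)) = 0" "n dvd (k :: nat)"
  shows "(\<Sum>i<k. g) = 0"
proof -
  obtain t where "k = n * t" using assms(2) by (elim dvdE)
  moreover have "(\<Sum>i<n * t. g) = 0"
    by (induction t) (simp_all add: multiple_add assms(1))
  ultimately show ?thesis by simp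
qed

lemma group_exponent_exists:
  "\<exists>n :: nat. 0 < n \<and> (\<forall>g :: 'g :: {ab_group_add, finite}. (\<Sum>i<n. g) = 0)"
proof -
  have "\<exists>n>0::nat. (\<Sum>i<n. g) = 0" for g :: 'g
  proof -
    have "\<not> inj (\<lambda>n :: nat. \<Sum>i<n. g)"
      using finite_imageD[of "\<lambda>n :: nat. \<Sum>i<n. g" UNIV] by auto
    then obtain a b :: nat where ab: "a < b" "(\<Sum>i<a. g) = (\<Sum>i<b. g)"
      unfolding inj_def by (metis linorder_neqE_nat)
    then have "(\<Sum>i<a + (b - a). g) = (\<Sum>i<a. g)" by simp
    then have "(\<Sum>i<b - a. g) = 0" unfolding multiple_add by simp
    then show ?thesis using ab(1) by (intro exI[of _ "b - a"]) simp
  qed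
  then obtain f where f: "\<And>g :: 'g. 0 < f g \<and> (\<Sum>i<(f g :: nat). g) = 0" by metis
  have "(\<Sum>i<(\<Prod>x\<in>UNIV. f x). g) = 0" for g :: 'g
    by (rule multiple_zero_dvd[where n = "f g"]) (use f in \<open>auto intro: dvd_prodI\<close>)
  moreover have "0 < (\<Prod>x\<in>UNIV. f x)" using f by (simp add: prod_pos)
  ultimately show ?thesis by blast
qed

lemma davenport_exists:
  "\<exists>d. 0 < d \<and> (\<forall>s :: nat \<Rightarrow> 'g :: {ab_group_add, finite}. \<exists>I \<subseteq> {..<d}. I \<noteq> {} \<and> (\<Sum>i\<in>I. s i) = 0)"
proof (rule exI[of _ "card (UNIV :: 'g set)"], intro conjI allI)
  show "0 < card (UNIV :: 'g set)" by (simp add: finite_UNIV_card_ge_0)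
  fix s :: "nat \<Rightarrow> 'g"
  let ?d = "card (UNIV :: 'g set)"
  have "\<not> inj_on (\<lambda>k. \<Sum>i<k. s i) {..?d}"
  proof
    assume "inj_on (\<lambda>k. \<Sum>i<k. s i) {..?d}"
    then have "card {..?d} \<le> ?d" by (intro card_inj_on_le) auto
    then show False by simp
  qed
  then obtain a b where ab: "a < b" "b \<le> ?d" "(\<Sum>i<a. s i) = (\<Sum>i<b. s i)"
    unfolding inj_on_def by (metis atMost_iff linorder_neqE_nat)
  have "{..<b} = {..<a} \<union> {a..<b}" using ab(1) by auto
  then have "(\<Sum>i<b. s i) = (\<Sum>i<a. s i) + (\<Sum>i=a..<b. s i)"
    by (simp add: sum.union_disjoint ivl_disj_int)
  then have "(\<Sum>i=a..<b. s i) = 0" using ab(3) by simp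
  then show "\<exists>I \<subseteq> {..<?d}. I \<noteq> {} \<and> (\<Sum>i\<in>I. s i) = 0"
    using ab(1,2) by (intro exI[of _ "{a..<b}"]) auto
qed

lemma delta_ramsey_exists:
  assumes "q < r" "group_exponent TYPE('g :: {ab_group_add, finite}) dvd m"
  shows "\<exists>d. 0 < d \<and> (\<forall>c :: nat set \<Rightarrow> 'g. \<exists>e. delta_system r q m e \<and>
    (\<forall>i\<in>{1..m}. e i \<in> complete_edges r d) \<and> (\<Sum>i=1..m. c (e i)) = 0)"
proof -
  define N where "N = card (UNIV :: 'g set) * m + 1"
  define B where "B = (\<lambda>k. {..<q} \<union> {q + k * (r - q)..<q + (k + 1) * (r - q)})"
  have B_int: "B a \<inter> B b = {..<q}" if "a < b" for a b
  proof -
    have "(a + 1) * (r - q) \<le> b * (r - q)" using that by (intro mult_right_mono) auto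
    then show ?thesis unfolding B_def by auto
  qed
  have B_card: "card (B k) = r" for k
    unfolding B_def using assms(1)
    by (subst card_Un_disjoint) auto
  have B_edge: "B k \<in> complete_edges r (q + N * (r - q))" if "k < N" for k
  proof -
    have "(k + 1) * (r - q) \<le> N * (r - q)" using that by (intro mult_right_mono) auto
    then show ?thesis unfolding complete_edges_def using B_card by (auto simp: B_def)
  qed
  have B_inj: "a = b" if "B a = B b" for a b
  proof (rule ccontr)
    assume "a \<noteq> b"
    then have "B a = {..<q}" using B_int[of a b] B_int[of b a] that by (cases "a < b") auto
    then show False using B_card[of a] assms(1) by simp
  qed
  have "\<exists>e. delta_system r q m e \<and>
    (\<forall>i\<in>{1..m}. e i \<in> complete_edges r (q + N * (r - q))) \<and> (\<Sum>i=1..m. c (e i)) = 0"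
    for c :: "nat set \<Rightarrow> 'g"
  proof -
    have "\<exists>g. m \<le> card {k\<in>{..<N}. c (B k) = g}"
    proof (rule ccontr)
      assume "\<nexists>g. m \<le> card {k\<in>{..<N}. c (B k) = g}"
      then have "card {k\<in>{..<N}. c (B k) = g} \<le> m" for g by (meson linear)
      then have "(\<Sum>g\<in>UNIV. card {k\<in>{..<N}. c (B k) = g}) \<le> (\<Sum>g\<in>(UNIV :: 'g set). m)"
        by (intro sum_mono) auto
      moreover have "(\<Sum>g\<in>UNIV. card {k\<in>{..<N}. c (B k) = g}) = card (\<Union>g. {k\<in>{..<N}. c (B k) = g})"
        by (intro card_UN_disjoint[symmetric]) auto
      moreover have "(\<Union>g. {k\<in>{..<N}. c (B k) = g}) = {..<N}" by auto
      ultimately show False unfolding N_def by simp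
    qed
    then obtain g where "m \<le> card {k\<in>{..<N}. c (B k) = g}" by blast
    then obtain K where K: "K \<subseteq> {k\<in>{..<N}. c (B k) = g}" "card K = m" "finite K"
      by (rule obtain_subset_with_card_n)
    obtain h where h: "bij_betw h {1..m} K"
      using K(2,3) ex_bij_betw_nat_finite_1 by blast
    have hK: "h i \<in> K" if "i \<in> {1..m}" for i using h that by (auto simp: bij_betw_def)
    have hN: "h i < N \<and> c (B (h i)) = g" if "i \<in> {1..m}" for i
      using hK[OF that] K(1) by blast
    have h_inj: "h i \<noteq> h j" if "i \<in> {1..m}" "j \<in> {1..m}" "i \<noteq> j" for i j
      using inj_onD[OF bij_betw_imp_inj_on[OF h]] that by blast
    have "delta_system r q m (\<lambda>i. B (h i))"
      unfolding delta_system_def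
    proof (intro conjI exI[of _ "{..<q}"] ballI allI impI)
      show "inj_on (\<lambda>i. B (h i)) {1..m}" using h_inj B_inj by (meson inj_onI)
      fix i j assume "1 \<le> i \<and> i < j \<and> j \<le> m"
      then have "h i \<noteq> h j" using h_inj[of i j] by auto
      then show "B (h i) \<inter> B (h j) = {..<q}"
        using B_int[of "h i" "h j"] B_int[of "h j" "h i"] by (cases "h i < h j") auto
    qed (use assms(1) B_card in \<open>auto simp: B_def\<close>)
    moreover have "\<forall>i\<in>{1..m}. B (h i) \<in> complete_edges r (q + N * (r - q))"
      using hN B_edge by blast
    moreover have "(\<Sum>i=1..m. c (B (h i))) = (\<Sum>i=1..m. g)"
      using hN by (intro sum.cong) blast+
    moreover have "(\<Sum>i=1..m. g) = (\<Sum>i<m. g)"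
      by (rule sum.reindex_bij_witness[of _ Suc "\<lambda>i. i - 1"]) auto
    moreover have "(\<Sum>i<m. g) = 0"
    proof (rule multiple_zero_dvd[OF _ assms(2)])
      show "(\<Sum>i<group_exponent TYPE('g). g) = 0"
        using LeastI_ex[OF group_exponent_exists[where ?'g = 'g]] unfolding group_exponent_def by blast
    qed
    ultimately show ?thesis by (intro exI[of _ "\<lambda>i. B (h i)"]) simp
  qed
  moreover have "0 < q + N * (r - q)" using assms(1) by (simp add: N_def)
  ultimately show ?thesis by blast
qed

end

theory Submission
  imports
    Defs
    "HOL-Algebra.Multiplicative_Group"
    "HOL-Library.Disjoint_Sets"
    "HOL-Library.Set_Algebras"
begin

text \<open>Write \<open>s = r - q\<close>, \<open>n = |G|\<close> and \<open>D = D(G)\<close>. Fixing the core reduces the upper bounds to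
  finding \<open>m\<close> disjoint \<open>s\<close>-sets with zero colour sum. On \<open>s * (m + D - 1)\<close> vertices, partition into
  \<open>s\<close>-sets and apply Gao's theorem to the sequence of their colours. On \<open>s * m + n - 1\<close> vertices,
  first split off a zero-sum matching of size \<open>m - n\<close>, which exists because every sequence of length
  \<open>m\<close> has a zero-sum subsequence of length \<open>m - n\<close>. For the remaining case \<open>m = n\<close> the bound is
  multiplicative along a chain of subgroups, so it suffices to treat a maximal subgroup \<open>B\<close> of a
  group \<open>A\<close>. Colour the edges by the \<open>k = |A| / |B|\<close> cosets of \<open>B\<close>: either \<open>k\<close> disjoint edges have
  the same colour, and their sum lies in \<open>B\<close>, or \<open>k - 1\<close> disjoint \<open>(s + 1)\<close>-sets see two colours
  each, and the choices between them sum to everything modulo \<open>B\<close>.\<close>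

section \<open>Subgroups and the exponent\<close>

locale add_subgroup =
  fixes B :: "'g :: ab_group_add set"
  assumes zero_mem: "0 \<in> B"
    and diff_mem: "x \<in> B \<Longrightarrow> y \<in> B \<Longrightarrow> x - y \<in> B"
begin

lemma uminus_mem: "x \<in> B \<Longrightarrow> - x \<in> B"
  using diff_mem[OF zero_mem, of x] by simp

lemma add_mem: "x \<in> B \<Longrightarrow> y \<in> B \<Longrightarrow> x + y \<in> B"
  using diff_mem[of x "- y"] uminus_mem[of y] by simp

lemma sum_mem: "(\<And>i. i \<in> I \<Longrightarrow> f i \<in> B) \<Longrightarrow> sum f I \<in> B"
  by (induction I rule: infinite_finite_induct) (auto intro: zero_mem add_mem)

lemma coset_eq_iff: "x +o B = y +o B \<longleftrightarrow> x - y \<in> B"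
proof
  assume "x +o B = y +o B"
  then have "x + 0 \<in> y +o B" using zero_mem by blast
  then show "x - y \<in> B" by (simp add: set_minus_plus)
next
  assume mem: "x - y \<in> B"
  have "z - x \<in> B \<longleftrightarrow> z - y \<in> B" for z
    using add_mem[OF _ mem, of "z - x"] diff_mem[OF _ mem, of "z - y"] by auto
  then show "x +o B = y +o B" by (simp add: set_minus_plus set_eq_iff)
qed

lemma sum_coset_cong:
  assumes "\<And>i. i \<in> I \<Longrightarrow> f i +o B = h i +o B"
  shows "sum f I +o B = sum h I +o B"
  using sum_mem[of I "\<lambda>i. f i - h i"] assms by (simp add: coset_eq_iff sum_subtractf)

lemma plus_self: "B + B = B"
  using zero_mem add_mem by (auto simp: set_plus_def) (metis add_0_left)

end

lemma add_subgroup_UNIV: "add_subgroup UNIV"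
  and add_subgroup_zero: "add_subgroup {0}"
  by unfold_locales auto

definition additive_group :: "'g :: ab_group_add set \<Rightarrow> 'g monoid" where
  "additive_group A = \<lparr>carrier = A, mult = (+), one = 0\<rparr>"

lemma comm_group_additive_group:
  assumes "add_subgroup A"
  shows "comm_group (additive_group A)"
proof -
  interpret A: add_subgroup A by fact
  show ?thesis
  proof (rule comm_groupI)
    fix x assume "x \<in> carrier (additive_group A)"
    then show "\<exists>y\<in>carrier (additive_group A). y \<otimes>\<^bsub>additive_group A\<^esub> x = \<one>\<^bsub>additive_group A\<^esub>"
      using A.uminus_mem by (intro bexI[of _ "- x"]) (auto simp: additive_group_def)
  qed (auto simp: additive_group_def add.assoc add.commute A.add_mem A.zero_mem)
qed

lemma subgroup_additive_group:
  assumes "add_subgroup A" "add_subgroup B" "B \<subseteq> A"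
  shows "subgroup B (additive_group A)"
proof -
  interpret A: comm_group "additive_group A" using assms(1) by (rule comm_group_additive_group)
  interpret B: add_subgroup B by fact
  show ?thesis
  proof (rule A.subgroupI)
    fix x assume "x \<in> B"
    then have "inv\<^bsub>additive_group A\<^esub> x = - x"
      using assms(3) B.uminus_mem by (intro A.inv_equality) (auto simp: additive_group_def)
    then show "inv\<^bsub>additive_group A\<^esub> x \<in> B" using B.uminus_mem[OF \<open>x \<in> B\<close>] by simp
  qed (use assms(3) B.zero_mem B.add_mem in \<open>auto simp: additive_group_def\<close>)
qed

lemma nat_pow_additive_group: "g [^]\<^bsub>additive_group A\<^esub> (n :: nat) = (\<Sum>i<n. g)"
  by (induction n) (simp_all add: nat_pow_def additive_group_def)

lemma card_subgroup_dvd: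
  fixes A B :: "'g :: {ab_group_add, finite} set"
  assumes "add_subgroup A" "add_subgroup B" "B \<subseteq> A"
  shows "card B dvd card A"
proof -
  interpret A: comm_group "additive_group A" using assms(1) by (rule comm_group_additive_group)
  have "card (rcosets\<^bsub>additive_group A\<^esub> B) * card B = card A"
    using A.lagrange[OF subgroup_additive_group[OF assms]]
    by (simp add: additive_group_def order_def)
  then show ?thesis by (metis dvd_triv_right)
qed

lemma index_multiple_mem:
  fixes A B :: "'g :: {ab_group_add, finite} set"
  assumes "add_subgroup A" "add_subgroup B" "B \<subseteq> A" "card A = k * card B" "g \<in> A"
  shows "(\<Sum>i<k. g) \<in> B"
proof -
  let ?G = "additive_group A"
  interpret A: comm_group ?G using assms(1) by (rule comm_group_additive_group)
  interpret B: add_subgroup B by fact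
  have sub: "subgroup B ?G" using assms(1-3) by (rule subgroup_additive_group)
  then interpret N: normal B ?G by (rule A.subgroup_imp_normal)
  interpret Q: group "?G Mod B" by (rule N.factorgroup_is_group)
  have carrier_eq: "carrier ?G = A" by (simp add: additive_group_def)
  have "order (?G Mod B) * card B = card A"
    using A.lagrange[OF sub] carrier_eq by (simp add: FactGroup_def order_def)
  moreover have "0 < card B" using B.zero_mem by (auto simp: card_gt_0_iff)
  ultimately have "order (?G Mod B) = k" using assms(4) by auto
  moreover have "finite (carrier (?G Mod B))" by simp
  moreover have "B #>\<^bsub>?G\<^esub> g \<in> carrier (?G Mod B)"
    using N.r_coset_hom_Mod assms(5) carrier_eq by (auto simp: hom_def)
  ultimately have "(B #>\<^bsub>?G\<^esub> g) [^]\<^bsub>?G Mod B\<^esub> k = \<one>\<^bsub>?G Mod B\<^esub>"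
    using Q.pow_order_eq_1 by blast
  moreover have "B #>\<^bsub>?G\<^esub> (g [^]\<^bsub>?G\<^esub> k) = (B #>\<^bsub>?G\<^esub> g) [^]\<^bsub>?G Mod B\<^esub> k"
    using Group.hom_nat_pow[OF N.r_coset_hom_Mod _ A.is_group Q.is_group] assms(5) carrier_eq
    by simp
  ultimately have "B #>\<^bsub>?G\<^esub> (\<Sum>i<k. g) = B"
    by (simp add: FactGroup_def nat_pow_additive_group)
  then show ?thesis
    using A.coset_join1[OF _ _ sub] assms(1,5) by (simp add: carrier_eq add_subgroup.sum_mem)
qed

lemma sum_const_eq_multiple: "(\<Sum>i\<in>I. g) = (\<Sum>i<card I. (g :: 'g :: ab_group_add))"
  by (induction I rule: infinite_finite_induct) (simp_all add: add.commute)

lemma group_exponent_dvd_iff: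
  "group_exponent TYPE('g :: {ab_group_add, finite}) dvd k \<longleftrightarrow> (\<forall>g :: 'g. (\<Sum>i<k. g) = 0)"
proof
  let ?e = "group_exponent TYPE('g)"
  have exponent: "0 < ?e" "(\<Sum>i<?e. g) = 0" for g :: 'g
    using LeastI_ex[OF group_exponent_exists[where ?'g = 'g]] unfolding group_exponent_def by auto
  show "\<forall>g :: 'g. (\<Sum>i<k. g) = 0" if "?e dvd k"
    using multiple_zero_dvd[OF exponent(2) that] by blast
  show "?e dvd k" if zero: "\<forall>g :: 'g. (\<Sum>i<k. g) = 0"
  proof -
    have "(\<Sum>i<k mod ?e. g) = 0" for g :: 'g
    proof -
      have "(\<Sum>i<k. g) = (\<Sum>i<?e * (k div ?e). g) + (\<Sum>i<k mod ?e. g)"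
        unfolding multiple_add[symmetric] by simp
      then show ?thesis using zero multiple_zero_dvd[OF exponent(2), of "?e * (k div ?e)" g] by simp
    qed
    moreover have "k mod ?e < ?e" using exponent(1) by simp
    then have "\<not> (0 < k mod ?e \<and> (\<forall>g :: 'g. (\<Sum>i<k mod ?e. g) = 0))"
      unfolding group_exponent_def by (rule not_less_Least)
    ultimately show ?thesis by (simp add: dvd_eq_mod_eq_0)
  qed
qed

lemma group_exponent_dvd_card:
  "group_exponent TYPE('g) dvd card (UNIV :: 'g :: {ab_group_add, finite} set)"
  unfolding group_exponent_dvd_iff
  using index_multiple_mem[OF add_subgroup_UNIV add_subgroup_zero, of "card (UNIV :: 'g set)"]
  by auto

lemma sum_translate:
  fixes g :: "'g :: {ab_group_add, finite}"
  assumes "group_exponent TYPE('g) dvd card I"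
  shows "(\<Sum>i\<in>I. f i - g) = sum f I"
  using assms sum_const_eq_multiple[of g I] by (simp add: sum_subtractf group_exponent_dvd_iff)

section \<open>Scherk's theorem and short zero-sum subsequences\<close>

lemma card_elt_set_plus: "card (a +o X) = card (X :: 'g :: ab_group_add set)"
proof -
  have "a +o X = (+) a ` X" by (auto simp: elt_set_plus_def)
  then show ?thesis by (simp add: card_image)
qed

definition dyson_left :: "'g :: ab_group_add \<Rightarrow> 'g set \<Rightarrow> 'g set \<Rightarrow> 'g set" where
  "dyson_left a A B = A \<union> (a +o B)"

definition dyson_right :: "'g :: ab_group_add \<Rightarrow> 'g set \<Rightarrow> 'g set \<Rightarrow> 'g set" where
  "dyson_right a A B = {b \<in> B. a + b \<in> A}"

lemma card_dyson_transform:
  assumes "finite A" "finite B"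
  shows "card (dyson_left a A B) + card (dyson_right a A B) = card A + card B"
proof -
  have "A \<inter> (a +o B) = a +o dyson_right a A B"
    by (auto simp: dyson_right_def elt_set_plus_def)
  then have "card (A \<inter> (a +o B)) = card (dyson_right a A B)" by (simp add: card_elt_set_plus)
  moreover have "finite (a +o B)" using assms(2) by (simp add: elt_set_plus_def)
  ultimately show ?thesis
    using card_Un_Int[OF assms(1), of "a +o B"] by (simp add: dyson_left_def card_elt_set_plus)
qed

lemma dyson_transform_sumset_subset: "dyson_left a A B + dyson_right a A B \<subseteq> A + B"
proof
  fix z assume "z \<in> dyson_left a A B + dyson_right a A B"
  then obtain x y where xy: "z = x + y" "x \<in> dyson_left a A B" "y \<in> B" "a + y \<in> A"
    unfolding dyson_right_def by (elim set_plus_elim) simp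
  show "z \<in> A + B"
  proof (cases "x \<in> A")
    case True
    then show ?thesis using xy by blast
  next
    case False
    then obtain b where b: "b \<in> B" "x = a + b"
      using xy(2) by (auto simp: dyson_left_def elt_set_plus_def)
    then have "z = (a + y) + b" using xy(1) by (simp add: ac_simps)
    then show ?thesis using b(1) xy(4) by blast
  qed
qed

lemma dyson_transform_zero_sum:
  assumes unique: "\<And>x y. x \<in> A \<Longrightarrow> y \<in> B \<Longrightarrow> x + y = 0 \<Longrightarrow> x = 0"
    and "a \<in> A" "x \<in> dyson_left a A B" "y \<in> dyson_right a A B" "x + y = 0"
  shows "x = 0"
proof (cases "x \<in> A")
  case True
  then show ?thesis using unique assms(4,5) by (auto simp: dyson_right_def)
next
  case False
  then obtain b where b: "b \<in> B" "x = a + b"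
    using assms(3) by (auto simp: dyson_left_def elt_set_plus_def)
  have y: "a + y \<in> A" "y \<in> B" using assms(4) by (auto simp: dyson_right_def)
  have "(a + y) + b = 0" using assms(5) b(2) by (simp add: ac_simps)
  then have "a + y = 0" using unique[OF y(1) b(1)] by simp
  then have "a = 0" using unique[OF assms(2) y(2)] by simp
  then show ?thesis using \<open>a + y = 0\<close> assms(5) by simp
qed

theorem scherk:
  fixes A B :: "'g :: ab_group_add set"
  assumes "finite A" "finite B" "0 \<in> A" "0 \<in> B"
    and "\<And>x y. x \<in> A \<Longrightarrow> y \<in> B \<Longrightarrow> x + y = 0 \<Longrightarrow> x = 0"
  shows "card A + card B \<le> card (A + B) + 1"
  using assms
proof (induction "card B" arbitrary: A B rule: less_induct)
  case less
  show ?case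
  proof (cases "B = {0}")
    case True
    then show ?thesis by simp
  next
    case False
    then obtain b where b: "b \<in> B" "b \<noteq> 0" using less.prems(4) by blast
    have "\<not> (\<lambda>x. x + b) ` A \<subseteq> A"
    proof
      assume "(\<lambda>x. x + b) ` A \<subseteq> A"
      then have "(\<lambda>x. x + b) ` A = A" using less.prems(1) by (intro endo_inj_surj) auto
      then obtain x where "x \<in> A" "x + b = 0" using less.prems(3) by (metis imageE)
      then show False using less.prems(5) b by fastforce
    qed
    then obtain a where a: "a \<in> A" "a + b \<notin> A" by blast
    let ?A = "dyson_left a A B" and ?B = "dyson_right a A B"
    have fin: "finite ?A" "finite ?B"
      using less.prems(1,2) by (auto simp: dyson_left_def dyson_right_def elt_set_plus_def)
    have zero: "0 \<in> ?A" "0 \<in> ?B"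
      using less.prems(3,4) a(1) by (auto simp: dyson_left_def dyson_right_def)
    have "?B \<subset> B" using a(2) b(1) by (auto simp: dyson_right_def)
    then have smaller: "card ?B < card B" using less.prems(2) by (simp add: psubset_card_mono)
    have "card A + card B = card ?A + card ?B"
      using card_dyson_transform[OF less.prems(1,2)] by simp
    also have "\<dots> \<le> card (?A + ?B) + 1"
      using dyson_transform_zero_sum[OF less.prems(5) a(1)]
      by (intro less.hyps[OF smaller fin zero])
    also have "\<dots> \<le> card (A + B) + 1"
      using finite_set_plus[OF less.prems(1,2)] dyson_transform_sumset_subset[of a A B]
      by (simp add: card_mono)
    finally show ?thesis .
  qed
qed

lemma scherk_sum:
  fixes A :: "'k \<Rightarrow> 'g :: ab_group_add set"
  assumes "finite K" "\<And>k. k \<in> K \<Longrightarrow> finite (A k)" "\<And>k. k \<in> K \<Longrightarrow> 0 \<in> A k"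
    and "\<And>s k. \<lbrakk>\<And>k. k \<in> K \<Longrightarrow> s k \<in> A k; sum s K = 0; k \<in> K\<rbrakk> \<Longrightarrow> s k = 0"
  shows "(\<Sum>k\<in>K. card (A k)) + 1 \<le> card (sum A K) + card K"
  using assms
proof (induction K rule: finite_induct)
  case empty
  then show ?case by simp
next
  case (insert j K)
  have extend: "x = 0 \<and> (\<forall>k\<in>K. s k = 0)"
    if x: "x \<in> A j" and s: "\<And>k. k \<in> K \<Longrightarrow> s k \<in> A k" and zero: "x + sum s K = 0" for x s
  proof -
    let ?s = "s(j := x)"
    have sum: "sum ?s (insert j K) = x + sum s K"
      using insert.hyps by (auto intro!: arg_cong2[where f = "(+)"] sum.cong)
    have mem: "?s k \<in> A k" if "k \<in> insert j K" for k using x s that by auto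
    have vanish: "?s k = 0" if "k \<in> insert j K" for k
      using insert.prems(3)[OF mem _ that] sum zero by simp
    have "s k = 0" if "k \<in> K" for k using vanish[of k] that insert.hyps(2) by (cases "k = j") auto
    then show ?thesis using vanish[of j] by simp
  qed
  have "s k = 0" if "\<And>k. k \<in> K \<Longrightarrow> s k \<in> A k" "sum s K = 0" "k \<in> K" for s k
    using extend[of 0 s] insert.prems(2) that by simp
  then have step: "(\<Sum>k\<in>K. card (A k)) + 1 \<le> card (sum A K) + card K"
    using insert.IH insert.prems(1,2) by simp
  have "card (A j) + card (sum A K) \<le> card (A j + sum A K) + 1"
  proof (rule scherk)
    show "finite (sum A K)"
      using insert.hyps(1) insert.prems(1)
      by (induction K rule: finite_induct) (auto intro: finite_set_plus)
    show "0 \<in> sum A K"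
      using insert.prems(2)
      by (auto simp: set_sum_alt[OF insert.hyps(1)] intro!: exI[of _ "\<lambda>_. 0"])
    fix x y assume "x \<in> A j" "y \<in> sum A K" "x + y = 0"
    moreover from this(2) obtain s where "\<forall>k\<in>K. s k \<in> A k" "y = sum s K"
      by (auto simp: set_sum_alt[OF insert.hyps(1)])
    ultimately show "x = 0" using extend[of x s] by blast
  qed (use insert.prems in auto)
  then show ?case using step insert.hyps by simp
qed

lemma ex_label_inj_on_fibres:
  assumes "finite I" "\<And>x. card {i \<in> I. f i = x} \<le> h"
  obtains l :: "'i \<Rightarrow> nat" where "l ` I \<subseteq> {..<h}" "\<And>k. inj_on f {i \<in> I. l i = k}"
proof -
  have "\<exists>l :: 'i \<Rightarrow> nat. l ` {i \<in> I. f i = x} \<subseteq> {..<h} \<and> inj_on l {i \<in> I. f i = x}" for x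
    using inj_on_iff_card_le[of "{i \<in> I. f i = x}" "{..<h}"] assms by auto
  then obtain l :: "_ \<Rightarrow> 'i \<Rightarrow> nat" where
    l: "\<And>x. l x ` {i \<in> I. f i = x} \<subseteq> {..<h} \<and> inj_on (l x) {i \<in> I. f i = x}" by metis
  show ?thesis
  proof (rule that[of "\<lambda>i. l (f i) i"])
    show "(\<lambda>i. l (f i) i) ` I \<subseteq> {..<h}" using l by blast
    show "inj_on f {i \<in> I. l (f i) i = k}" for k
      using l by (auto simp: inj_on_def)
  qed
qed

lemma ex_selection_with_sum:
  assumes "finite K" "\<And>k. k \<in> K \<Longrightarrow> s k \<in> insert 0 (f ` {i \<in> I. l i = k})"
  obtains J where "J \<subseteq> I" "inj_on l J" "l ` J = {k \<in> K. s k \<noteq> 0}" "sum f J = sum s K"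
proof -
  let ?L = "{k \<in> K. s k \<noteq> 0}"
  have "\<exists>i\<in>I. l i = k \<and> f i = s k" if "k \<in> ?L" for k using assms(2)[of k] that by auto
  then obtain p where p: "\<And>k. k \<in> ?L \<Longrightarrow> p k \<in> I \<and> l (p k) = k \<and> f (p k) = s k" by metis
  then have inj: "inj_on p ?L" by (intro inj_on_inverseI[of _ l]) blast
  have "sum f (p ` ?L) = sum s ?L" using p by (intro sum.reindex_cong[OF inj refl]) blast
  also have "\<dots> = sum s K" by (rule sum.mono_neutral_left) (use assms(1) in auto)
  finally have "sum f (p ` ?L) = sum s K" .
  moreover have "l ` p ` ?L = ?L" using p by force
  moreover have "inj_on l (p ` ?L)" using p by (intro inj_on_inverseI[of _ p]) force
  moreover have "p ` ?L \<subseteq> I" using p by blast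
  ultimately show ?thesis using that by blast
qed

lemma ex_short_zero_sum:
  fixes f :: "'i \<Rightarrow> 'g :: {ab_group_add, finite}"
  assumes "finite I" "card (UNIV :: 'g set) \<le> card I" "\<And>x. card {i \<in> I. f i = x} \<le> h"
  obtains J where "J \<subseteq> I" "J \<noteq> {}" "card J \<le> h" "sum f J = 0"
proof (rule ccontr)
  assume "\<not> thesis"
  then have no_short: "\<And>J. J \<subseteq> I \<Longrightarrow> J \<noteq> {} \<Longrightarrow> card J \<le> h \<Longrightarrow> sum f J \<noteq> 0" using that by blast
  obtain l :: "'i \<Rightarrow> nat" where l: "l ` I \<subseteq> {..<h}" "\<And>k. inj_on f {i \<in> I. l i = k}"
    using ex_label_inj_on_fibres[OF assms(1,3)] by blast
  have nonzero: "f i \<noteq> 0" if "i \<in> I" for i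
  proof -
    have "l i < h" using l(1) that by blast
    then show ?thesis using no_short[of "{i}"] that by simp
  qed
  let ?A = "\<lambda>k. insert 0 (f ` {i \<in> I. l i = k})"
  have "s k = 0" if s: "\<And>k. k \<in> {..<h} \<Longrightarrow> s k \<in> ?A k" "sum s {..<h} = 0" "k \<in> {..<h}" for s k
  proof -
    obtain J where J: "J \<subseteq> I" "inj_on l J" "l ` J = {k \<in> {..<h}. s k \<noteq> 0}" "sum f J = sum s {..<h}"
      using ex_selection_with_sum[of "{..<h}" s f I l] s(1) by blast
    have "card J \<le> card {..<h}" using J(2,3) by (intro card_inj_on_le[of l]) auto
    then have "J = {}" using no_short[OF J(1)] J(4) s(2) by auto
    then show ?thesis using J(3) s(3) by blast
  qed
  then have "(\<Sum>k<h. card (?A k)) + 1 \<le> card (sum ?A {..<h}) + h"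
    using scherk_sum[of "{..<h}" ?A] assms(1) by simp
  moreover have "card (?A k) = card {i \<in> I. l i = k} + 1" for k
  proof -
    have "0 \<notin> f ` {i \<in> I. l i = k}" using nonzero by force
    then show ?thesis using assms(1) by (simp add: card_image[OF l(2)])
  qed
  moreover have "(\<Sum>k<h. card {i \<in> I. l i = k}) = card I"
    using sum.group[OF assms(1) _ l(1), of "\<lambda>_. 1 :: nat"] by simp
  ultimately have "card I + 1 \<le> card (sum ?A {..<h})" by (simp add: sum_Suc)
  also have "\<dots> \<le> card (UNIV :: 'g set)" by (intro card_mono) auto
  finally show False using assms(2) by simp
qed

section \<open>Zero-sum subsequences of prescribed length\<close>

lemma ex_translate_most_frequent_zero:
  fixes f :: "'i \<Rightarrow> 'g :: ab_group_add"
  assumes "finite I"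
  obtains g where "\<And>x. card {i \<in> I. f i - g = x} \<le> card {i \<in> I. f i - g = 0}"
proof -
  let ?count = "\<lambda>x. card {i \<in> I. f i = x}"
  have "\<exists>g. True \<and> (\<forall>x. True \<longrightarrow> ?count x \<le> ?count g)"
    by (rule ex_has_greatest_nat[of _ 0 _ "Suc (card I)"])
      (auto simp: less_Suc_eq_le assms intro!: card_mono)
  then obtain g where g: "\<And>x. ?count x \<le> ?count g" by blast
  have "card {i \<in> I. f i - g = x} \<le> card {i \<in> I. f i - g = 0}" for x
    using g[of "x + g"] by (simp add: diff_eq_eq)
  then show ?thesis using that by blast
qed

text \<open>Nonzero terms are discarded in zero-sum pieces no longer than the number of zeros, so the
  number of nonzero terms drops to at most \<open>t\<close> before the total length drops below \<open>t\<close>.\<close>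

lemma ex_same_sum_few_nonzero:
  fixes f :: "'i \<Rightarrow> 'g :: {ab_group_add, finite}"
  assumes "finite I" and most_zeros: "\<And>x. card {i \<in> I. f i = x} \<le> card {i \<in> I. f i = 0}"
    and "card (UNIV :: 'g set) \<le> t + 1" "t \<le> card I"
  obtains Y where "{i \<in> I. f i = 0} \<subseteq> Y" "Y \<subseteq> I" "sum f Y = sum f I" "t \<le> card Y"
    "card (Y - {i \<in> I. f i = 0}) \<le> t"
proof -
  define Z where "Z = {i \<in> I. f i = 0}"
  let ?P = "\<lambda>Y. Z \<subseteq> Y \<and> Y \<subseteq> I \<and> sum f Y = sum f I \<and> t \<le> card Y"
  have "?P I" using assms(4) by (auto simp: Z_def)
  from ex_has_least_nat[of ?P, OF this, of card]
  obtain Y where Y: "?P Y" and least: "\<And>Y'. ?P Y' \<Longrightarrow> card Y \<le> card Y'" by blast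
  have fin: "finite Y" "finite Z" using Y assms(1) by (auto simp: Z_def intro: finite_subset)
  have "card (Y - Z) \<le> t"
  proof (rule ccontr)
    assume many: "\<not> card (Y - Z) \<le> t"
    have "card {i \<in> Y - Z. f i = x} \<le> card Z" for x
    proof -
      have "card {i \<in> Y - Z. f i = x} \<le> card {i \<in> I. f i = x}"
        using Y assms(1) by (intro card_mono) auto
      then show ?thesis using most_zeros[of x] by (simp add: Z_def)
    qed
    moreover have "card (UNIV :: 'g set) \<le> card (Y - Z)" using many assms(3) by linarith
    ultimately obtain J where
      J: "J \<subseteq> Y - Z" "J \<noteq> {}" "card J \<le> card Z" "sum f J = 0"
      using ex_short_zero_sum[of "Y - Z" f "card Z"] fin(1) by blast
    have finJ: "finite J" using J(1) fin(1) finite_subset by blast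
    have "card Y = card (Y - Z) + card Z"
      using card_Int_Diff[OF fin(1), of Z] Y by (simp add: Int_absorb1)
    moreover have card_diff: "card (Y - J) = card Y - card J"
      using J(1) finJ by (intro card_Diff_subset) auto
    ultimately have "t \<le> card (Y - J)" using many J(3) by linarith
    moreover have "sum f (Y - J) = sum f I" using J Y fin(1) by (subst sum_diff) auto
    ultimately have "card Y \<le> card (Y - J)" using J(1) Y by (intro least) auto
    moreover have "0 < card J" "card J \<le> card Y"
      using J finJ fin(1) by (auto simp: card_gt_0_iff intro: card_mono)
    ultimately show False using card_diff by linarith
  qed
  then show ?thesis using that[of Y] Y by (simp add: Z_def)
qed

lemma ex_subset_card_same_sum:
  fixes f :: "'i \<Rightarrow> 'g :: {ab_group_add, finite}"
  assumes "finite I" "\<And>x. card {i \<in> I. f i = x} \<le> card {i \<in> I. f i = 0}"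
    and "card (UNIV :: 'g set) \<le> t + 1" "t \<le> card I"
  obtains J where "J \<subseteq> I" "card J = t" "sum f J = sum f I"
proof -
  let ?Z = "{i \<in> I. f i = 0}"
  obtain Y where Y: "?Z \<subseteq> Y" "Y \<subseteq> I" "sum f Y = sum f I" "t \<le> card Y" "card (Y - ?Z) \<le> t"
    by (rule ex_same_sum_few_nonzero[OF assms])
  have fin: "finite Y" using Y(2) assms(1) finite_subset by blast
  then obtain J where J: "Y - ?Z \<subseteq> J" "J \<subseteq> Y" "card J = t"
    using exists_subset_between[of "Y - ?Z" t Y] Y(4,5) by blast
  have "sum f J = sum f Y" using J fin by (intro sum.mono_neutral_left) auto
  then show ?thesis using that[of J] J(2,3) Y(2,3) by simp
qed

lemma ex_zero_sum_card:
  fixes f :: "'i \<Rightarrow> 'g :: {ab_group_add, finite}"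
  assumes "finite I" "group_exponent TYPE('g) dvd k" "k + card (UNIV :: 'g set) \<le> card I + 1"
  obtains J where "J \<subseteq> I" "card J = k" "sum f J = 0"
proof -
  obtain g where "\<And>x. card {i \<in> I. f i - g = x} \<le> card {i \<in> I. f i - g = 0}"
    using ex_translate_most_frequent_zero[OF assms(1)] by blast
  moreover have "0 < card (UNIV :: 'g set)" by (simp add: finite_UNIV_card_ge_0)
  then have k: "k \<le> card I" using assms(3) by linarith
  moreover have "card (UNIV :: 'g set) \<le> card I - k + 1" using assms(3) k by linarith
  ultimately obtain Y where Y: "Y \<subseteq> I" "card Y = card I - k" "(\<Sum>i\<in>Y. f i - g) = (\<Sum>i\<in>I. f i - g)"
    using ex_subset_card_same_sum[OF assms(1), of "\<lambda>i. f i - g" "card I - k"] by auto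
  have card: "card (I - Y) = k"
    using Y(1,2) assms(1) k by (simp add: card_Diff_subset finite_subset)
  have "sum f (I - Y) = (\<Sum>i\<in>I - Y. f i - g)" using assms(2) card by (simp add: sum_translate)
  also have "\<dots> = (\<Sum>i\<in>I. f i - g) - (\<Sum>i\<in>Y. f i - g)" using Y(1) assms(1) by (rule sum_diff[rotated])
  also have "\<dots> = 0" using Y(3) by simp
  finally show ?thesis using that[of "I - Y"] card by blast
qed

lemma ex_zero_sum_davenport:
  fixes f :: "'i \<Rightarrow> 'g :: {ab_group_add, finite}"
  assumes "finite I" "davenport TYPE('g) \<le> card I"
  obtains J where "J \<subseteq> I" "J \<noteq> {}" "sum f J = 0"
proof -
  obtain \<beta> where \<beta>: "bij_betw \<beta> {..<card I} I"
    using ex_bij_betw_nat_finite[OF assms(1)] by (metis atLeast0LessThan)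
  obtain K where K: "K \<subseteq> {..<davenport TYPE('g)}" "K \<noteq> {}" "(\<Sum>i\<in>K. f (\<beta> i)) = 0"
    using LeastI_ex[OF davenport_exists[where ?'g = 'g]] unfolding davenport_def by meson
  have "K \<subseteq> {..<card I}" using K(1) assms(2) by force
  then have "inj_on \<beta> K" "\<beta> ` K \<subseteq> I" using \<beta> by (auto simp: bij_betw_def inj_on_subset)
  then show ?thesis using that[of "\<beta> ` K"] K by (simp add: sum.reindex)
qed

lemma ex_zero_sum_free_davenport:
  obtains s :: "nat \<Rightarrow> 'g :: {ab_group_add, finite}" where
    "\<And>I. I \<subseteq> {..<davenport TYPE('g) - 1} \<Longrightarrow> I \<noteq> {} \<Longrightarrow> sum s I \<noteq> 0"
proof (cases "davenport TYPE('g) - 1 = 0")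
  case True
  then show ?thesis using that by simp
next
  case False
  then have "davenport TYPE('g) - 1 < davenport TYPE('g)" by simp
  then have "\<not> (0 < davenport TYPE('g) - 1 \<and>
      (\<forall>s :: nat \<Rightarrow> 'g. \<exists>I \<subseteq> {..<davenport TYPE('g) - 1}. I \<noteq> {} \<and> (\<Sum>i\<in>I. s i) = 0))"
    unfolding davenport_def by (rule not_less_Least)
  then show ?thesis using False that by auto
qed

lemma ex_large_zero_sum:
  fixes f :: "'i \<Rightarrow> 'g :: {ab_group_add, finite}"
  assumes "finite I"
  obtains J where "J \<subseteq> I" "sum f J = 0" "card I < card J + davenport TYPE('g)"
proof -
  let ?P = "\<lambda>J. J \<subseteq> I \<and> sum f J = 0"
  have "\<exists>J. ?P J \<and> (\<forall>J'. ?P J' \<longrightarrow> card J' \<le> card J)"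
    by (rule ex_has_greatest_nat[of ?P "{}" card "Suc (card I)"])
      (auto intro!: le_imp_less_Suc card_mono assms)
  then obtain W where W: "?P W" and greatest: "\<And>J'. ?P J' \<Longrightarrow> card J' \<le> card W" by blast
  have finW: "finite W" using W assms finite_subset by blast
  have "card (I - W) < davenport TYPE('g)"
  proof (rule ccontr)
    assume "\<not> ?thesis"
    then obtain J where J: "J \<subseteq> I - W" "J \<noteq> {}" "sum f J = 0"
      using ex_zero_sum_davenport[of "I - W" f] assms by auto
    have finJ: "finite J" using J(1) assms finite_subset by blast
    have "W \<inter> J = {}" using J(1) by blast
    then have "card (W \<union> J) = card W + card J" "sum f (W \<union> J) = 0"
      using finW finJ J W by (auto simp: card_Un_disjoint sum.union_disjoint)
    moreover from this have "card (W \<union> J) \<le> card W" using W J by (intro greatest) auto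
    ultimately show False using J(2) finJ by simp
  qed
  then have "card I < card W + davenport TYPE('g)"
    using W finW assms card_mono by (fastforce simp: card_Diff_subset)
  then show ?thesis using that W by blast
qed

text \<open>The zeros are added to a large zero-sum subsequence so that 0 stays its most frequent value.\<close>

theorem gao_zero_sum:
  fixes f :: "'i \<Rightarrow> 'g :: {ab_group_add, finite}"
  assumes "finite I" "group_exponent TYPE('g) dvd m" "card (UNIV :: 'g set) \<le> m"
    and "m + davenport TYPE('g) \<le> card I + 1"
  obtains J where "J \<subseteq> I" "card J = m" "sum f J = 0"
proof -
  obtain g where g: "\<And>x. card {i \<in> I. f i - g = x} \<le> card {i \<in> I. f i - g = 0}"
    using ex_translate_most_frequent_zero[OF assms(1)] by blast
  define h where "h i = f i - g" for i
  obtain U where U: "U \<subseteq> I" "sum h U = 0" "card I < card U + davenport TYPE('g)"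
    using ex_large_zero_sum[OF assms(1), of h] by blast
  define W where "W = U \<union> {i \<in> I. h i = 0}"
  have fin: "finite W" using U(1) assms(1) finite_subset unfolding W_def by auto
  have "sum h W = sum h U" using fin by (intro sum.mono_neutral_right) (auto simp: W_def)
  then have W_sum: "sum h W = 0" using U(2) by simp
  have "card U \<le> card W" using fin by (intro card_mono) (auto simp: W_def)
  then have "m \<le> card W" using U(3) assms(4) by linarith
  moreover have "card {i \<in> W. h i = x} \<le> card {i \<in> W. h i = 0}" for x
  proof -
    have "card {i \<in> W. h i = x} \<le> card {i \<in> I. h i = x}"
      using U(1) assms(1) by (intro card_mono) (auto simp: W_def)
    also have "\<dots> \<le> card {i \<in> I. h i = 0}" using g[of x] by (simp add: h_def)
    also have "\<dots> \<le> card {i \<in> W. h i = 0}" using fin by (intro card_mono) (auto simp: W_def)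
    finally show ?thesis .
  qed
  ultimately obtain J where J: "J \<subseteq> W" "card J = m" "sum h J = 0"
    using ex_subset_card_same_sum[OF fin, of h m] assms(3) W_sum by auto
  have "sum f J = 0" using J(2,3) assms(2) by (simp add: h_def sum_translate)
  then show ?thesis using that[of J] J U(1) by (auto simp: W_def)
qed

section \<open>Matchings of uniform hypergraphs\<close>

definition uniform_matching :: "nat \<Rightarrow> 'v set \<Rightarrow> 'v set set \<Rightarrow> bool" where
  "uniform_matching s V M \<longleftrightarrow> disjoint M \<and> (\<forall>e\<in>M. e \<subseteq> V \<and> card e = s)"

lemma uniform_matchingD:
  assumes "uniform_matching s V M"
  shows "disjoint M" "\<And>e. e \<in> M \<Longrightarrow> e \<subseteq> V" "\<And>e. e \<in> M \<Longrightarrow> card e = s" "\<Union> M \<subseteq> V"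
  using assms by (auto simp: uniform_matching_def)

lemma uniform_matching_finite:
  assumes "uniform_matching s V M" "finite V"
  shows "finite M"
proof -
  have "M \<subseteq> Pow V" using uniform_matchingD(2)[OF assms(1)] by blast
  then show ?thesis using assms(2) by (meson finite_Pow_iff finite_subset)
qed

lemma card_uncovered:
  assumes "uniform_matching s V M" "finite V"
  shows "card (V - \<Union> M) + s * card M = card V"
proof -
  note M = uniform_matchingD[OF assms(1)]
  have "card (\<Union> M) = sum card M"
    using M(1,2) assms(2) by (intro card_Union_disjoint) (auto intro: finite_subset)
  also have "\<dots> = s * card M" using M(3) by simp
  finally have "card (\<Union> M) = s * card M" .
  moreover have "card (\<Union> M) \<le> card V" using M(4) assms(2) by (intro card_mono)
  ultimately show ?thesis
    using card_Diff_subset[OF finite_subset[OF M(4) assms(2)] M(4)] by simp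
qed

lemma uniform_matching_mono:
  "uniform_matching s V M \<Longrightarrow> M' \<subseteq> M \<Longrightarrow> V \<subseteq> V' \<Longrightarrow> uniform_matching s V' M'"
  unfolding uniform_matching_def by (meson pairwise_subset subset_iff subset_trans)

lemma uniform_matching_Union: "uniform_matching s V M \<Longrightarrow> uniform_matching s (\<Union> M) M"
  by (auto simp: uniform_matching_def)

lemma uniform_matching_UN:
  assumes "disjoint_family_on V I" "\<And>i. i \<in> I \<Longrightarrow> uniform_matching s (V i) (M i)" "0 < s"
  shows "uniform_matching s (\<Union>i\<in>I. V i) (\<Union>i\<in>I. M i)" "disjoint_family_on M I"
proof -
  note M = uniform_matchingD[OF assms(2)]
  have disj: "disjoint_family_on (\<lambda>i. \<Union> (M i)) I"
    using assms(1) M(4) unfolding disjoint_family_on_def by (meson disjoint_iff subset_iff)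
  then have "disjoint (\<Union>i\<in>I. M i)" using M(1) by (intro disjoint_UN)
  then show "uniform_matching s (\<Union>i\<in>I. V i) (\<Union>i\<in>I. M i)"
    using M(2,3) by (auto simp: uniform_matching_def)
  have "e \<noteq> {}" if "i \<in> I" "e \<in> M i" for i e using M(3)[OF that] assms(3) by auto
  then show "disjoint_family_on M I" using disj by (fastforce simp: disjoint_family_on_def)
qed

lemma uniform_matching_Un:
  assumes "uniform_matching s V M" "uniform_matching s V' M'" "V \<inter> V' = {}" "0 < s"
  shows "uniform_matching s (V \<union> V') (M \<union> M')" "M \<inter> M' = {}"
proof -
  let ?V = "\<lambda>b. if b then V else V'" and ?M = "\<lambda>b. if b then M else M'"
  have "disjoint_family_on ?V UNIV" using assms(3) by (auto simp: disjoint_family_on_def)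
  moreover have "uniform_matching s (?V b) (?M b)" for b using assms(1,2) by simp
  ultimately have UN: "uniform_matching s (\<Union>b. ?V b) (\<Union>b. ?M b)" "disjoint_family_on ?M UNIV"
    using uniform_matching_UN[of ?V UNIV s ?M] assms(4) by blast+
  show "uniform_matching s (V \<union> V') (M \<union> M')" using UN(1) unfolding Un_eq_UN .
  show "M \<inter> M' = {}" using disjoint_family_onD[OF UN(2), of True False] by simp
qed

lemma uniform_matching_Un_uncovered:
  assumes "uniform_matching s V M" "uniform_matching s (V - \<Union> M) N" "0 < s"
  shows "uniform_matching s V (M \<union> N)" "M \<inter> N = {}"
proof -
  note un = uniform_matching_Un[OF uniform_matching_Union[OF assms(1)] assms(2) _ assms(3)]
  show "uniform_matching s V (M \<union> N)"
    using uniform_matching_mono[OF un(1)] uniform_matchingD(4)[OF assms(1)] by blast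
  show "M \<inter> N = {}" using un(2) by blast
qed

lemma uniform_matching_insert:
  assumes "uniform_matching s V M" "e \<subseteq> V - \<Union> M" "card e = s" "0 < s"
  shows "uniform_matching s V (insert e M)" "e \<notin> M"
proof -
  have "uniform_matching s (V - \<Union> M) {e}" using assms(2,3) by (simp add: uniform_matching_def)
  from uniform_matching_Un_uncovered[OF assms(1) this assms(4)]
  show "uniform_matching s V (insert e M)" "e \<notin> M" by simp_all
qed

lemma uniform_matching_choice:
  assumes "uniform_matching t V F" "\<And>K. K \<in> F \<Longrightarrow> \<phi> K \<subseteq> K" "\<And>K. K \<in> F \<Longrightarrow> card (\<phi> K) = s" "0 < s"
  shows "uniform_matching s V (\<phi> ` F)" "inj_on \<phi> F"
proof -
  have "disjoint_family_on (\<lambda>K. K) F"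
    using disjointD[OF uniform_matchingD(1)[OF assms(1)]] by (simp add: disjoint_family_on_def)
  moreover have "uniform_matching s K {\<phi> K}" if "K \<in> F" for K
    using assms(2,3) that by (simp add: uniform_matching_def)
  ultimately have UN: "uniform_matching s (\<Union> F) (\<phi> ` F)" "disjoint_family_on (\<lambda>K. {\<phi> K}) F"
    using uniform_matching_UN[of "\<lambda>K. K" F s "\<lambda>K. {\<phi> K}"] assms(4)
    by (simp_all add: UNION_singleton_eq_range)
  show "uniform_matching s V (\<phi> ` F)"
    using uniform_matching_mono[OF UN(1)] uniform_matchingD(4)[OF assms(1)] by blast
  show "inj_on \<phi> F"
    using UN(2) unfolding disjoint_family_on_def by (intro inj_onI) blast
qed

lemma ex_uniform_matching:
  assumes "finite V" "0 < s" "s * k \<le> card V"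
  obtains M where "uniform_matching s V M" "card M = k"
proof -
  have "\<exists>M. uniform_matching s V M \<and> card M = k"
    using assms(3)
  proof (induction k)
    case 0
    then show ?case by (intro exI[of _ "{}"]) (simp add: uniform_matching_def)
  next
    case (Suc k)
    then obtain M where M: "uniform_matching s V M" "card M = k" by auto
    have "s \<le> card (V - \<Union> M)" using card_uncovered[OF M(1) assms(1)] M(2) Suc.prems by simp
    then obtain e where e: "e \<subseteq> V - \<Union> M" "card e = s" by (rule obtain_subset_with_card_n)
    have "card (insert e M) = Suc k"
      using uniform_matching_insert(2)[OF M(1) e assms(2)]
        uniform_matching_finite[OF M(1) assms(1)] M(2) by simp
    then show ?case using uniform_matching_insert(1)[OF M(1) e assms(2)] by blast
  qed
  then show ?thesis using that by blast
qed

definition matching_sums :: "nat \<Rightarrow> 'v set \<Rightarrow> nat \<Rightarrow> ('v set \<Rightarrow> 'g :: comm_monoid_add) \<Rightarrow> 'g set" where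
  "matching_sums s V k c = {sum c M | M. uniform_matching s V M \<and> card M = k}"

lemma matching_sumsI:
  "uniform_matching s V M \<Longrightarrow> card M = k \<Longrightarrow> sum c M \<in> matching_sums s V k c"
  by (auto simp: matching_sums_def)

lemma matching_sumsE:
  assumes "x \<in> matching_sums s V k c"
  obtains M where "uniform_matching s V M" "card M = k" "sum c M = x"
  using assms by (auto simp: matching_sums_def)

lemma matching_sums_compose:
  fixes c :: "'v set \<Rightarrow> 'g :: comm_monoid_add"
  assumes "0 < s" "finite V"
    and inner: "\<And>S. S \<subseteq> V \<Longrightarrow> card S = t \<Longrightarrow> matching_sums s S a c \<inter> C \<noteq> {}"
    and outer: "\<And>d. (\<And>S. S \<subseteq> V \<Longrightarrow> card S = t \<Longrightarrow> d S \<in> C) \<Longrightarrow> matching_sums t V b d \<inter> B \<noteq> {}"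
  shows "matching_sums s V (a * b) c \<inter> B \<noteq> {}"
proof -
  have "\<exists>M. uniform_matching s S M \<and> card M = a \<and> sum c M \<in> C" if "S \<subseteq> V" "card S = t" for S
    using inner[OF that] by (auto simp: matching_sums_def)
  then obtain \<mu> where \<mu>: "\<And>S. S \<subseteq> V \<Longrightarrow> card S = t \<Longrightarrow>
      uniform_matching s S (\<mu> S) \<and> card (\<mu> S) = a \<and> sum c (\<mu> S) \<in> C" by metis
  have "matching_sums t V b (\<lambda>S. sum c (\<mu> S)) \<inter> B \<noteq> {}" by (rule outer) (simp add: \<mu>)
  then obtain N where N: "uniform_matching t V N" "card N = b" "(\<Sum>S\<in>N. sum c (\<mu> S)) \<in> B"
    by (auto simp: matching_sums_def)
  note N' = uniform_matchingD[OF N(1)]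
  have \<mu>N: "uniform_matching s S (\<mu> S)" "card (\<mu> S) = a" "finite (\<mu> S)" if "S \<in> N" for S
  proof -
    show matching: "uniform_matching s S (\<mu> S)" and "card (\<mu> S) = a"
      using \<mu> N'(2,3)[OF that] by auto
    show "finite (\<mu> S)"
      using finite_subset[OF N'(2)[OF that] assms(2)] by (rule uniform_matching_finite[OF matching])
  qed
  have finN: "finite N" using uniform_matching_finite[OF N(1) assms(2)] .
  have "disjoint_family_on (\<lambda>S. S) N"
    using disjointD[OF N'(1)] by (simp add: disjoint_family_on_def)
  from uniform_matching_UN[OF this \<mu>N(1) assms(1)]
  have UN: "uniform_matching s (\<Union>S\<in>N. S) (\<Union>S\<in>N. \<mu> S)" "disjoint_family_on \<mu> N" by simp_all
  have "uniform_matching s V (\<Union>S\<in>N. \<mu> S)"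
    using uniform_matching_mono[OF UN(1) subset_refl] N'(4) by simp
  moreover have "card (\<Union>S\<in>N. \<mu> S) = a * b"
    using card_UN_disjoint'[OF UN(2) \<mu>N(3) finN] \<mu>N(2) N(2) by simp
  moreover have "sum c (\<Union>S\<in>N. \<mu> S) = (\<Sum>S\<in>N. sum c (\<mu> S))"
    using \<mu>N(3) by (intro sum.UNION_disjoint_family[OF finN _ UN(2)] ballI)
  ultimately have "(\<Sum>S\<in>N. sum c (\<mu> S)) \<in> matching_sums s V (a * b) c"
    by (metis matching_sumsI)
  then show ?thesis using N(3) by blast
qed

section \<open>Monochromatic or polychromatic matchings\<close>

definition polychromatic :: "('v set \<Rightarrow> 'a) \<Rightarrow> nat \<Rightarrow> 'v set \<Rightarrow> bool" where
  "polychromatic \<chi> s K \<longleftrightarrow> (\<exists>e\<subseteq>K. \<exists>e'\<subseteq>K. card e = s \<and> card e' = s \<and> \<chi> e \<noteq> \<chi> e')"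

text \<open>Single vertex exchanges lead from \<open>e\<close> to \<open>e'\<close>, and one of them reaches the colour of \<open>e'\<close>.\<close>

lemma ex_polychromatic_between:
  assumes "finite e" "card e = s" "finite e'" "card e' = s" "\<chi> e \<noteq> \<chi> e'"
  obtains K f where "K \<subseteq> e \<union> e'" "card K = Suc s" "polychromatic \<chi> s K"
    "f \<subseteq> K" "card f = s" "\<chi> f = \<chi> e'"
proof -
  let ?P = "\<lambda>f. f \<subseteq> e \<union> e' \<and> card f = s \<and> \<chi> f \<noteq> \<chi> e'"
  have "\<exists>f. ?P f \<and> (\<forall>f'. ?P f' \<longrightarrow> card (f' \<inter> e') \<le> card (f \<inter> e'))"
  proof (rule ex_has_greatest_nat[of ?P e _ "Suc s"])
    show "\<forall>f. ?P f \<longrightarrow> card (f \<inter> e') < Suc s"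
      using card_mono[OF assms(3) Int_lower2] assms(4) by (simp add: less_Suc_eq_le)
  qed (use assms in auto)
  then obtain f where f: "?P f" and closest: "\<And>f'. ?P f' \<Longrightarrow> card (f' \<inter> e') \<le> card (f \<inter> e')" by blast
  have fin: "finite f" using f assms(1,3) by (meson finite_UnI finite_subset)
  have "f \<noteq> e'" using f by blast
  then have "\<not> e' \<subseteq> f" using card_subset_eq[OF fin, of e'] f assms(4) by auto
  then obtain y where y: "y \<in> e'" "y \<notin> f" by blast
  have "\<not> f \<subseteq> e'" using \<open>f \<noteq> e'\<close> card_subset_eq[OF assms(3), of f] f assms(4) by auto
  then obtain x where x: "x \<in> f" "x \<notin> e'" by blast
  let ?f' = "insert y (f - {x})"
  have card_f': "card ?f' = s" using fin x(1) y f card_Suc_Diff1[of f x] by simp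
  have "?f' \<inter> e' = insert y (f \<inter> e')" using x y by blast
  then have "card (?f' \<inter> e') = Suc (card (f \<inter> e'))" using y fin by simp
  then have colour_f': "\<chi> ?f' = \<chi> e'" using closest[of ?f'] card_f' f y(1) by auto
  show ?thesis
  proof (rule that[of "insert y f" ?f'])
    show "insert y f \<subseteq> e \<union> e'" using f y(1) by blast
    show "card (insert y f) = Suc s" using fin y(2) f by simp
    show "polychromatic \<chi> s (insert y f)"
      unfolding polychromatic_def using f card_f' colour_f'
      by (intro exI[of _ f] conjI exI[of _ ?f']) auto
  qed (use card_f' colour_f' in auto)
qed

locale uniform_colouring =
  fixes V :: "'v set" and s :: nat and \<chi> :: "'v set \<Rightarrow> 'a"
  assumes finite_V: "finite V" and s_pos: "0 < s"
begin

definition polychromatic_matching :: "'v set set \<Rightarrow> bool" where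
  "polychromatic_matching F \<longleftrightarrow> uniform_matching (Suc s) V F \<and> (\<forall>K\<in>F. polychromatic \<chi> s K)"

definition maximum_polychromatic_matching :: "'v set set \<Rightarrow> bool" where
  "maximum_polychromatic_matching F \<longleftrightarrow>
    polychromatic_matching F \<and> (\<forall>F'. polychromatic_matching F' \<longrightarrow> card F' \<le> card F)"

definition uncovered_in_colour :: "'a \<Rightarrow> 'v set set \<Rightarrow> bool" where
  "uncovered_in_colour g F \<longleftrightarrow> (\<forall>e \<subseteq> V - \<Union> F. card e = s \<longrightarrow> \<chi> e = g)"

definition contains_colour :: "'a \<Rightarrow> 'v set \<Rightarrow> bool" where
  "contains_colour g K \<longleftrightarrow> (\<exists>e \<subseteq> K. card e = s \<and> \<chi> e = g)"

lemma maximum_polychromatic_matchingD: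
  assumes "maximum_polychromatic_matching F"
  shows "polychromatic_matching F" "uniform_matching (Suc s) V F"
    "\<And>F'. polychromatic_matching F' \<Longrightarrow> card F' \<le> card F"
  using assms by (auto simp: maximum_polychromatic_matching_def polychromatic_matching_def)

lemma polychromatic_matching_finite: "polychromatic_matching F \<Longrightarrow> finite F"
  using uniform_matching_finite[OF _ finite_V] by (auto simp: polychromatic_matching_def)

lemma polychromatic_matching_card_le:
  assumes "polychromatic_matching F"
  shows "card F \<le> card V"
  using card_uncovered[OF conjunct1[OF assms[unfolded polychromatic_matching_def]] finite_V] by simp

lemma polychromatic_matching_insert:
  assumes "polychromatic_matching F" "K \<subseteq> V - \<Union> F" "card K = Suc s" "polychromatic \<chi> s K"
  shows "polychromatic_matching (insert K F)" "K \<notin> F"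
  using assms uniform_matching_insert[of "Suc s" V F K] by (auto simp: polychromatic_matching_def)

lemma maximum_polychromatic_matching_uncovered:
  assumes "maximum_polychromatic_matching F" "e \<subseteq> V - \<Union> F" "card e = s" "e' \<subseteq> V - \<Union> F" "card e' = s"
  shows "\<chi> e = \<chi> e'"
proof (rule ccontr)
  assume "\<chi> e \<noteq> \<chi> e'"
  moreover have "finite e" "finite e'"
    using assms(2,4) finite_V by (meson finite_Diff finite_subset)+
  ultimately obtain K where K: "K \<subseteq> e \<union> e'" "card K = Suc s" "polychromatic \<chi> s K"
    using ex_polychromatic_between[of e s e' \<chi>] assms(3,5) by metis
  note F = maximum_polychromatic_matchingD[OF assms(1)]
  have "K \<subseteq> V - \<Union> F" using K(1) assms(2,4) by blast
  from polychromatic_matching_insert[OF F(1) this K(2,3)]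
  have "card (insert K F) \<le> card F" "K \<notin> F" by (auto intro: F(3))
  then show False using polychromatic_matching_finite[OF F(1)] by simp
qed

text \<open>The new set \<open>K'\<close> lies between an edge of \<open>K\<close> and an uncovered edge \<open>S\<close>. The uncovered vertices
  outside \<open>S\<close> survive the replacement, so the uncovered edges keep the colour \<open>g\<close>.\<close>

lemma maximum_polychromatic_matching_exchange:
  assumes "maximum_polychromatic_matching F" "uncovered_in_colour g F" "2 * s \<le> card (V - \<Union> F)"
    and "K \<in> F" "\<not> contains_colour g K"
  obtains K' where "maximum_polychromatic_matching (insert K' (F - {K}))"
    "uncovered_in_colour g (insert K' (F - {K}))" "contains_colour g K'" "K' \<notin> F"
proof -
  note F = maximum_polychromatic_matchingD[OF assms(1)]
  have K: "K \<subseteq> V" "card K = Suc s" using uniform_matchingD[OF F(2)] assms(4) by auto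
  then obtain e where e: "e \<subseteq> K" "card e = s" "finite e"
    using obtain_subset_with_card_n[of s K] by auto
  obtain S where S: "S \<subseteq> V - \<Union> F" "card S = s" "finite S"
    using obtain_subset_with_card_n[of s "V - \<Union> F"] assms(3) by auto
  have S_colour: "\<chi> S = g" using assms(2) S by (simp add: uncovered_in_colour_def)
  then have "\<chi> e \<noteq> \<chi> S" using assms(5) e by (auto simp: contains_colour_def)
  then obtain K' f where K': "K' \<subseteq> e \<union> S" "card K' = Suc s" "polychromatic \<chi> s K'"
    and f: "f \<subseteq> K'" "card f = s" "\<chi> f = \<chi> S"
    using ex_polychromatic_between[OF e(3,2) S(3,2)] by blast
  let ?F = "insert K' (F - {K})"
  have contains: "contains_colour g K'" using f S_colour by (auto simp: contains_colour_def)
  have "K \<inter> \<Union> (F - {K}) = {}"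
    using disjointD[OF uniform_matchingD(1)[OF F(2)] assms(4)] by blast
  then have fresh: "K' \<subseteq> V - \<Union> (F - {K})" using K'(1) e(1) K(1) S(1) by blast
  have "polychromatic_matching (F - {K})"
    using F(1) uniform_matching_mono[OF F(2)] by (auto simp: polychromatic_matching_def)
  note F' = polychromatic_matching_insert[OF this fresh K'(2,3)]
  have "card ?F = card F"
    using polychromatic_matching_finite[OF F(1)] F'(2) assms(4) card_Suc_Diff1[of F K] by simp
  then have maximum: "maximum_polychromatic_matching ?F"
    using F'(1) F(3) by (simp add: maximum_polychromatic_matching_def)
  have "s \<le> card (V - \<Union> F - S)" using assms(3) S by (simp add: card_Diff_subset)
  then obtain e' where e': "e' \<subseteq> V - \<Union> F - S" "card e' = s" by (rule obtain_subset_with_card_n)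
  have uncovered: "e' \<subseteq> V - \<Union> ?F" using e'(1) K'(1) e(1) assms(4) by blast
  have "e' \<subseteq> V - \<Union> F" using e'(1) by blast
  then have "\<chi> e' = g" using e'(2) assms(2) by (simp add: uncovered_in_colour_def)
  then have "\<chi> f' = g" if "f' \<subseteq> V - \<Union> ?F" "card f' = s" for f'
    using maximum_polychromatic_matching_uncovered[OF maximum that uncovered e'(2)] by simp
  then have "uncovered_in_colour g ?F" unfolding uncovered_in_colour_def by blast
  moreover have "K' \<notin> F" using F'(2) contains assms(5) by blast
  ultimately show ?thesis using that[of K'] maximum contains by blast
qed

lemma ex_maximum_polychromatic_matching_containing_colour:
  assumes large: "\<And>F. polychromatic_matching F \<Longrightarrow> 2 * s \<le> card (V - \<Union> F)"
  obtains F g where "maximum_polychromatic_matching F" "uncovered_in_colour g F"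
    "\<And>K. K \<in> F \<Longrightarrow> contains_colour g K"
proof -
  have "polychromatic_matching {}" by (simp add: polychromatic_matching_def uniform_matching_def)
  then obtain F\<^sub>0 where F\<^sub>0: "maximum_polychromatic_matching F\<^sub>0"
    unfolding maximum_polychromatic_matching_def
    using ex_has_greatest_nat[of polychromatic_matching "{}" card "Suc (card V)"]
      polychromatic_matching_card_le le_imp_less_Suc by blast
  then have "s \<le> card (V - \<Union> F\<^sub>0)" using large maximum_polychromatic_matchingD(1) by fastforce
  then obtain e where e: "e \<subseteq> V - \<Union> F\<^sub>0" "card e = s" by (rule obtain_subset_with_card_n)
  define g where "g = \<chi> e"
  let ?P = "\<lambda>F. maximum_polychromatic_matching F \<and> uncovered_in_colour g F"
  let ?containing = "\<lambda>F. {K \<in> F. contains_colour g K}"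
  have "?P F\<^sub>0"
    using F\<^sub>0 maximum_polychromatic_matching_uncovered[OF F\<^sub>0 _ _ e]
    by (simp add: uncovered_in_colour_def g_def)
  moreover have "card (?containing F) < Suc (card V)" if "?P F" for F
  proof -
    have F: "polychromatic_matching F" using that maximum_polychromatic_matchingD(1) by blast
    have "card (?containing F) \<le> card F"
      using polychromatic_matching_finite[OF F] by (intro card_mono) auto
    then show ?thesis using polychromatic_matching_card_le[OF F] by linarith
  qed
  ultimately have "\<exists>F. ?P F \<and> (\<forall>F'. ?P F' \<longrightarrow> card (?containing F') \<le> card (?containing F))"
    by (intro ex_has_greatest_nat[of ?P F\<^sub>0 _ "Suc (card V)"]) auto
  then obtain F where F: "?P F"
    and best: "\<And>F'. ?P F' \<Longrightarrow> card (?containing F') \<le> card (?containing F)" by blast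
  note poly = maximum_polychromatic_matchingD(1)[OF conjunct1[OF F]]
  have "contains_colour g K" if K: "K \<in> F" for K
  proof (rule ccontr)
    assume lacks: "\<not> contains_colour g K"
    obtain K' where K': "maximum_polychromatic_matching (insert K' (F - {K}))"
      "uncovered_in_colour g (insert K' (F - {K}))" "contains_colour g K'" "K' \<notin> F"
      using maximum_polychromatic_matching_exchange[OF _ _ large[OF poly] K lacks] F by blast
    have "?containing (insert K' (F - {K})) = insert K' (?containing F)" using K'(3) lacks by auto
    then have "card (insert K' (?containing F)) \<le> card (?containing F)"
      using best[of "insert K' (F - {K})"] K' by simp
    then show False using K'(4) polychromatic_matching_finite[OF poly] by simp
  qed
  then show ?thesis using that F by blast
qed

lemma ex_monochromatic_matching:
  assumes "uniform_matching (Suc s) V F" "uncovered_in_colour g F" "\<And>K. K \<in> F \<Longrightarrow> contains_colour g K"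
    and "s * k \<le> card (V - \<Union> F)"
  obtains M where "uniform_matching s V M" "card M = card F + k" "\<And>e. e \<in> M \<Longrightarrow> \<chi> e = g"
proof -
  obtain \<phi> where \<phi>: "\<And>K. K \<in> F \<Longrightarrow> \<phi> K \<subseteq> K" "\<And>K. K \<in> F \<Longrightarrow> card (\<phi> K) = s"
    and colour_\<phi>: "\<And>K. K \<in> F \<Longrightarrow> \<chi> (\<phi> K) = g"
    using assms(3) unfolding contains_colour_def by metis
  have choice: "uniform_matching s V (\<phi> ` F)" "inj_on \<phi> F"
    using uniform_matching_choice[OF assms(1) \<phi> s_pos] by simp_all
  have "finite (V - \<Union> F)" using finite_V by simp
  then obtain N where N: "uniform_matching s (V - \<Union> F) N" "card N = k"
    using ex_uniform_matching[OF _ s_pos assms(4)] by blast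
  have "V - \<Union> F \<subseteq> V - \<Union> (\<phi> ` F)" using \<phi>(1) by blast
  note un = uniform_matching_Un_uncovered[OF choice(1)
      uniform_matching_mono[OF N(1) subset_refl this] s_pos]
  have "finite (\<phi> ` F \<union> N)" using uniform_matching_finite[OF un(1) finite_V] .
  then have "card (\<phi> ` F \<union> N) = card F + k"
    using un(2) N(2) choice(2) by (simp add: card_Un_disjoint card_image)
  moreover have "\<chi> e = g" if "e \<in> \<phi> ` F \<union> N" for e
    using that colour_\<phi> uniform_matchingD(2,3)[OF N(1)] assms(2)
    by (auto simp: uncovered_in_colour_def)
  ultimately show ?thesis using that un(1) by blast
qed

theorem polychromatic_or_monochromatic_matching:
  assumes "s * Suc k + k \<le> card V"
  obtains (polychromatic) F where "uniform_matching (Suc s) V F" "card F = k"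
      "\<And>K. K \<in> F \<Longrightarrow> polychromatic \<chi> s K"
    | (monochromatic) M g where "uniform_matching s V M" "card M = Suc k" "\<And>e. e \<in> M \<Longrightarrow> \<chi> e = g"
proof (cases "\<exists>F. polychromatic_matching F \<and> k \<le> card F")
  case True
  then obtain F F' where "polychromatic_matching F" "F' \<subseteq> F" "card F' = k"
    by (meson obtain_subset_with_card_n)
  then show ?thesis
    using polychromatic[of F'] uniform_matching_mono[of "Suc s" V F F' V]
    by (auto simp: polychromatic_matching_def)
next
  case False
  have uncovered: "s * (Suc k - card F) + (k - card F) \<le> card (V - \<Union> F)" "card F < k"
    if "polychromatic_matching F" for F
  proof -
    show less: "card F < k" using False that by force
    then obtain j where k_eq: "k = card F + j" using less_imp_add_positive by blast
    have "card (V - \<Union> F) + Suc s * card F = card V"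
      using that by (intro card_uncovered finite_V) (simp add: polychromatic_matching_def)
    then show "s * (Suc k - card F) + (k - card F) \<le> card (V - \<Union> F)"
      using assms unfolding k_eq by (simp add: algebra_simps)
  qed
  have "2 * s \<le> card (V - \<Union> F)" if "polychromatic_matching F" for F
  proof -
    have "2 \<le> Suc k - card F" using uncovered(2)[OF that] by simp
    then have "2 * s \<le> s * (Suc k - card F)" by (simp add: mult.commute)
    then show ?thesis using uncovered(1)[OF that] by linarith
  qed
  then obtain F g where F: "maximum_polychromatic_matching F" "uncovered_in_colour g F"
    "\<And>K. K \<in> F \<Longrightarrow> contains_colour g K"
    using ex_maximum_polychromatic_matching_containing_colour by blast
  note poly = maximum_polychromatic_matchingD(1,2)[OF F(1)]
  have "s * (Suc k - card F) \<le> card (V - \<Union> F)" using uncovered(1)[OF poly(1)] by simp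
  then obtain M where "uniform_matching s V M" "card M = card F + (Suc k - card F)"
    "\<And>e. e \<in> M \<Longrightarrow> \<chi> e = g"
    using ex_monochromatic_matching[OF poly(2) F(2,3)] by blast
  then show ?thesis using monochromatic[of M g] uncovered(2)[OF poly(1)] by simp
qed

end

section \<open>Matchings with sum in a subgroup\<close>

definition maximal_subgroup :: "'g :: ab_group_add set \<Rightarrow> 'g set \<Rightarrow> bool" where
  "maximal_subgroup B A \<longleftrightarrow> add_subgroup A \<and> add_subgroup B \<and> B \<subseteq> A \<and>
    (\<forall>C. add_subgroup C \<longrightarrow> B \<subseteq> C \<longrightarrow> C \<subseteq> A \<longrightarrow> C = B \<or> C = A)"

lemma maximal_subgroupD:
  assumes "maximal_subgroup B A"
  shows "add_subgroup A" "add_subgroup B" "B \<subseteq> A"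
    "\<And>C. add_subgroup C \<Longrightarrow> B \<subseteq> C \<Longrightarrow> C \<subseteq> A \<Longrightarrow> C = B \<or> C = A"
  using assms by (auto simp: maximal_subgroup_def)

lemma plus_doubleton: "X + {a, b} = (a +o X) \<union> (b +o X)" for a :: "'g :: ab_group_add"
  by (auto simp: set_plus_def elt_set_plus_def add.commute)

lemma add_subgroup_stabilizer:
  assumes "add_subgroup A"
  shows "add_subgroup {d \<in> A. d +o X = X}"
proof -
  interpret A: add_subgroup A by fact
  show ?thesis
  proof
    fix x y assume xy: "x \<in> {d \<in> A. d +o X = X}" "y \<in> {d \<in> A. d +o X = X}"
    have "(x - y) +o X = (x - y) +o (y +o X)" using xy(2) by simp
    also have "\<dots> = X" using xy(1) by (simp add: set_plus_rearrange2)
    finally show "x - y \<in> {d \<in> A. d +o X = X}" using xy A.diff_mem by simp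
  qed (simp add: A.zero_mem)
qed

lemma eq_of_translation_invariant:
  assumes "add_subgroup A" "X \<subseteq> A" "X \<noteq> {}" "\<And>d. d \<in> A \<Longrightarrow> d +o X = X"
  shows "X = A"
proof
  interpret A: add_subgroup A by fact
  obtain x where x: "x \<in> X" using assms(3) by blast
  show "A \<subseteq> X"
  proof
    fix y assume "y \<in> A"
    then have "(y - x) +o X = X" using assms(2) x A.diff_mem by (intro assms(4)) auto
    then have "(y - x) + x \<in> X" using x by blast
    then show "y \<in> X" by simp
  qed
qed fact

text \<open>The stabilizer of \<open>X\<close> contains \<open>a - b\<close> besides \<open>B\<close>.\<close>

lemma eq_of_translates_eq:
  assumes "maximal_subgroup B A" "X \<subseteq> A" "X \<noteq> {}" and periodic: "X + B = X"
    and "a \<in> A" "b \<in> A" "a +o B \<noteq> b +o B" "a +o X = b +o X"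
  shows "X = A"
proof -
  note maximal = maximal_subgroupD[OF assms(1)]
  interpret A: add_subgroup A by (rule maximal)
  interpret B: add_subgroup B by (rule maximal)
  let ?C = "{d \<in> A. d +o X = X}"
  have "B \<subseteq> ?C"
  proof
    fix d assume d: "d \<in> B"
    have "d +o X = X + (d +o B)" using periodic by (simp add: set_plus_rearrange4)
    also have "d +o B = B" using d B.coset_eq_iff[of d 0] by simp
    finally show "d \<in> ?C" using d maximal(3) periodic by auto
  qed
  moreover have "a - b \<in> ?C"
  proof -
    have "(a - b) +o X = (- b) +o (a +o X)" by (simp add: set_plus_rearrange2)
    also have "\<dots> = X" using assms(8) by (simp add: set_plus_rearrange2)
    finally show ?thesis using assms(5,6) A.diff_mem by simp
  qed
  moreover have "a - b \<notin> B" using assms(7) B.coset_eq_iff by blast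
  ultimately have "?C = A" using maximal(4)[OF add_subgroup_stabilizer[OF maximal(1), of X]] by blast
  then show ?thesis using eq_of_translation_invariant[OF maximal(1) assms(2,3)] by blast
qed

lemma card_Un_translates:
  fixes B X :: "'g :: {ab_group_add, finite} set"
  assumes "add_subgroup B" and periodic: "X + B = X" and "a +o X \<noteq> b +o X"
  shows "card X + card B \<le> card ((a +o X) \<union> (b +o X))"
proof -
  interpret B: add_subgroup B by fact
  have "\<not> b +o X \<subseteq> a +o X"
    using assms(3) card_subset_eq[of "a +o X" "b +o X"] by (auto simp: card_elt_set_plus)
  then obtain x where x: "x \<in> X" "b + x \<notin> a +o X" by (auto simp: elt_set_plus_def)
  let ?Y = "(b + x) +o B"
  have "?Y = b +o (x +o B)" by (simp add: set_plus_rearrange2)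
  also have "\<dots> \<subseteq> b +o (X + B)" using x(1) by (intro set_plus_mono set_plus_mono3)
  finally have "?Y \<subseteq> b +o X" using periodic by simp
  have "(a +o X) \<inter> ?Y = {}"
  proof (rule equals0I)
    fix z assume "z \<in> (a +o X) \<inter> ?Y"
    then obtain d x' where d: "d \<in> B" "x' \<in> X" "(b + x) + d = a + x'"
      by (auto simp: elt_set_plus_def)
    have "x' + - d \<in> X" using d(1,2) B.uminus_mem periodic by blast
    moreover have "b + x = a + (x' + - d)" using d(3) by (simp add: algebra_simps)
    ultimately show False using x(2) by (auto simp: elt_set_plus_def)
  qed
  then have "card X + card B = card ((a +o X) \<union> ?Y)"
    by (simp add: card_Un_disjoint card_elt_set_plus)
  also have "\<dots> \<le> card ((a +o X) \<union> (b +o X))"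
    using \<open>?Y \<subseteq> b +o X\<close> by (intro card_mono) auto
  finally show ?thesis .
qed

lemma card_plus_sum_doubletons:
  fixes A B :: "'g :: {ab_group_add, finite} set"
  assumes "maximal_subgroup B A" "finite F"
    and "\<And>K. K \<in> F \<Longrightarrow> a K \<in> A \<and> b K \<in> A \<and> a K +o B \<noteq> b K +o B"
  shows "B + (\<Sum>K\<in>F. {a K, b K}) \<subseteq> A \<and> (B + (\<Sum>K\<in>F. {a K, b K}) = A \<or>
    (card F + 1) * card B \<le> card (B + (\<Sum>K\<in>F. {a K, b K})))"
  using assms(2,3)
proof (induction F rule: finite_induct)
  case empty
  then show ?case using maximal_subgroupD(3)[OF assms(1)] by simp
next
  case (insert K F)
  note maximal = maximal_subgroupD[OF assms(1)]
  interpret A: add_subgroup A by (rule maximal)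
  interpret B: add_subgroup B by (rule maximal)
  define X where "X = B + (\<Sum>K\<in>F. {a K, b K})"
  have X: "X \<subseteq> A" "X = A \<or> (card F + 1) * card B \<le> card X"
    using insert.IH insert.prems by (auto simp: X_def)
  have ab: "a K \<in> A" "b K \<in> A" "a K +o B \<noteq> b K +o B" using insert.prems by auto
  have step: "B + (\<Sum>K\<in>insert K F. {a K, b K}) = X + {a K, b K}"
    using insert.hyps by (simp add: X_def ac_simps)
  have subset: "X + {a K, b K} \<subseteq> A" using X(1) ab A.add_mem by (auto simp: set_plus_def)
  have "X + {a K, b K} = A \<or> (card (insert K F) + 1) * card B \<le> card (X + {a K, b K})"
  proof (cases "X = A")
    case True
    have "card A = card (a K +o X)" using True by (simp add: card_elt_set_plus)
    also have "\<dots> \<le> card (X + {a K, b K})" by (intro card_mono) (auto simp: plus_doubleton)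
    finally show ?thesis using subset by (intro disjI1 card_seteq) auto
  next
    case False
    have "X + B = (B + B) + (\<Sum>K\<in>F. {a K, b K})" by (simp add: X_def ac_simps)
    then have "X + B = X" by (simp add: B.plus_self X_def)
    moreover have "X \<noteq> {}" using X(2) False B.zero_mem by auto
    ultimately have "a K +o X \<noteq> b K +o X"
      using eq_of_translates_eq[OF assms(1) X(1) _ _ ab] False by blast
    then have "card X + card B \<le> card (X + {a K, b K})"
      using card_Un_translates[OF maximal(2) \<open>X + B = X\<close>] by (simp add: plus_doubleton)
    then show ?thesis using False X(2) insert.hyps by simp
  qed
  then show ?case using subset unfolding step by blast
qed

lemma plus_sum_doubletons_eq:
  fixes A B :: "'g :: {ab_group_add, finite} set"
  assumes "maximal_subgroup B A" "finite F"
    and "\<And>K. K \<in> F \<Longrightarrow> a K \<in> A \<and> b K \<in> A \<and> a K +o B \<noteq> b K +o B"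
    and "card A \<le> (card F + 1) * card B"
  shows "B + (\<Sum>K\<in>F. {a K, b K}) = A"
proof -
  let ?S = "B + (\<Sum>K\<in>F. {a K, b K})"
  have S: "?S \<subseteq> A" "?S = A \<or> (card F + 1) * card B \<le> card ?S"
    using card_plus_sum_doubletons[OF assms(1-3)] by simp_all
  from S(2) show ?thesis
  proof
    assume "(card F + 1) * card B \<le> card ?S"
    then have "card A \<le> card ?S" using assms(4) by linarith
    then show ?thesis using S(1) by (intro card_seteq) simp_all
  qed
qed

lemma ex_choice_sum_mem_coset:
  fixes A B :: "'g :: {ab_group_add, finite} set"
  assumes "maximal_subgroup B A" "finite F"
    and "\<And>K. K \<in> F \<Longrightarrow> f (a K) \<in> A \<and> f (b K) \<in> A \<and> f (a K) +o B \<noteq> f (b K) +o B"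
    and "card A \<le> (card F + 1) * card B" "x \<in> A"
  obtains \<psi> where "\<And>K. K \<in> F \<Longrightarrow> \<psi> K \<in> {a K, b K}" "x - (\<Sum>K\<in>F. f (\<psi> K)) \<in> B"
proof -
  have "B + (\<Sum>K\<in>F. {f (a K), f (b K)}) = A"
    using assms(1-4) by (rule plus_sum_doubletons_eq)
  with assms(5) have "x \<in> B + (\<Sum>K\<in>F. {f (a K), f (b K)})" by simp
  then obtain d y where d: "x = d + y" "d \<in> B" and y: "y \<in> (\<Sum>K\<in>F. {f (a K), f (b K)})"
    by (rule set_plus_elim)
  from y obtain t where t: "\<And>K. K \<in> F \<Longrightarrow> t K \<in> {f (a K), f (b K)}" "y = sum t F"
    by (auto simp: set_sum_alt[OF assms(2)])
  define \<psi> where "\<psi> K = (if t K = f (a K) then a K else b K)" for K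
  have "f (\<psi> K) = t K" if "K \<in> F" for K using t(1)[OF that] by (auto simp: \<psi>_def)
  then have "x - (\<Sum>K\<in>F. f (\<psi> K)) \<in> B" using d t(2) by simp
  then show ?thesis using that[of \<psi>] by (simp add: \<psi>_def)
qed

lemma polychromatic_matching_sum:
  fixes A B :: "'g :: {ab_group_add, finite} set" and c :: "'v set \<Rightarrow> 'g"
  assumes "maximal_subgroup B A" "card A = (card F + 1) * card B" "0 < s" "finite V"
    and colour_mem: "\<And>e. e \<subseteq> V \<Longrightarrow> card e = s \<Longrightarrow> c e \<in> A"
    and F: "uniform_matching (Suc s) V F" "\<And>K. K \<in> F \<Longrightarrow> polychromatic (\<lambda>e. c e +o B) s K"
    and "Suc s * card F + s \<le> card V"
  shows "matching_sums s V (card F + 1) c \<inter> B \<noteq> {}"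
proof -
  note maximal = maximal_subgroupD[OF assms(1)]
  interpret A: add_subgroup A by (rule maximal)
  interpret B: add_subgroup B by (rule maximal)
  have finF: "finite F" using uniform_matching_finite[OF F(1) assms(4)] .
  have "\<exists>e\<subseteq>K. \<exists>e'\<subseteq>K. card e = s \<and> card e' = s \<and> c e +o B \<noteq> c e' +o B" if "K \<in> F" for K
    using F(2)[OF that] unfolding polychromatic_def .
  then obtain a b where ab: "\<And>K. K \<in> F \<Longrightarrow> a K \<subseteq> K \<and> b K \<subseteq> K \<and> card (a K) = s \<and> card (b K) = s \<and>
      c (a K) +o B \<noteq> c (b K) +o B" by metis
  have "s \<le> card (V - \<Union> F)" using card_uncovered[OF F(1) assms(4)] assms(8) by linarith
  then obtain e where e: "e \<subseteq> V - \<Union> F" "card e = s" by (rule obtain_subset_with_card_n)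
  have colours: "c (a K) \<in> A \<and> c (b K) \<in> A \<and> c (a K) +o B \<noteq> c (b K) +o B" if "K \<in> F" for K
  proof -
    have "a K \<subseteq> V" "b K \<subseteq> V" using ab[OF that] uniform_matchingD(2)[OF F(1) that] by auto
    then show ?thesis using ab[OF that] by (simp add: colour_mem)
  qed
  have "c e \<in> A" using colour_mem[of e] e by auto
  then have "- c e \<in> A" by (rule A.uminus_mem)
  moreover have "card A \<le> (card F + 1) * card B" using assms(2) by simp
  ultimately obtain \<psi> where \<psi>: "\<And>K. K \<in> F \<Longrightarrow> \<psi> K \<in> {a K, b K}"
    and \<psi>_sum: "- c e - (\<Sum>K\<in>F. c (\<psi> K)) \<in> B"
    using ex_choice_sum_mem_coset[where f = c and a = a and b = b, OF assms(1) finF colours]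
    by blast
  have \<psi>_edge: "\<psi> K \<subseteq> K" "card (\<psi> K) = s" if "K \<in> F" for K
    using ab[OF that] \<psi>[OF that] by auto
  have choice: "uniform_matching s V (\<psi> ` F)" "inj_on \<psi> F"
    using uniform_matching_choice[OF F(1) \<psi>_edge assms(3)] by simp_all
  have "e \<subseteq> V - \<Union> (\<psi> ` F)" using e(1) \<psi>_edge(1) by blast
  note M = uniform_matching_insert[OF choice(1) this e(2) assms(3)]
  have "sum c (insert e (\<psi> ` F)) = - (- c e - (\<Sum>K\<in>F. c (\<psi> K)))"
    using M(2) finF choice(2) by (simp add: sum.reindex)
  then have "sum c (insert e (\<psi> ` F)) \<in> B" using B.uminus_mem[OF \<psi>_sum] by simp
  moreover have "card (insert e (\<psi> ` F)) = card F + 1"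
    using M(2) finF choice(2) by (simp add: card_image)
  ultimately show ?thesis using matching_sumsI[OF M(1)] by blast
qed

lemma monochromatic_matching_sum:
  fixes A B :: "'g :: {ab_group_add, finite} set" and c :: "'v set \<Rightarrow> 'g"
  assumes "add_subgroup A" "add_subgroup B" "B \<subseteq> A" "card A = card M * card B"
    and "\<And>e. e \<in> M \<Longrightarrow> c e \<in> A" "\<And>e. e \<in> M \<Longrightarrow> c e +o B = \<gamma>"
  shows "sum c M \<in> B"
proof -
  interpret B: add_subgroup B by fact
  show ?thesis
  proof (cases "M = {}")
    case False
    then obtain e where e: "e \<in> M" by blast
    let ?S = "\<Sum>_\<in>M. c e"
    have "sum c M +o B = ?S +o B" using assms(6) e by (intro B.sum_coset_cong) simp
    then have "sum c M - ?S \<in> B" using B.coset_eq_iff by blast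
    moreover have "?S \<in> B"
      using index_multiple_mem[OF assms(1-4) assms(5)[OF e]]
      by (simp add: sum_const_eq_multiple[of _ M])
    ultimately have "sum c M - ?S + ?S \<in> B" by (rule B.add_mem)
    then show ?thesis by simp
  qed (simp add: B.zero_mem)
qed

lemma matching_sums_meet_maximal_subgroup:
  fixes A B :: "'g :: {ab_group_add, finite} set" and c :: "'v set \<Rightarrow> 'g"
  assumes "maximal_subgroup B A" "card A = k * card B" "0 < s" "finite V" "s * k + k \<le> card V + 1"
    and colour_mem: "\<And>e. e \<subseteq> V \<Longrightarrow> card e = s \<Longrightarrow> c e \<in> A"
  shows "matching_sums s V k c \<inter> B \<noteq> {}"
proof -
  note maximal = maximal_subgroupD[OF assms(1)]
  interpret A: add_subgroup A by (rule maximal)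
  interpret colouring: uniform_colouring V s "\<lambda>e. c e +o B"
    using assms(3,4) by unfold_locales
  have "card A \<noteq> 0" using A.zero_mem by auto
  then obtain j where k_eq: "k = Suc j" using assms(2) by (cases k) auto
  have size: "s * Suc j + j \<le> card V" using assms(5) by (simp add: k_eq)
  then show ?thesis
  proof (cases rule: colouring.polychromatic_or_monochromatic_matching)
    case (polychromatic F)
    have "matching_sums s V (card F + 1) c \<inter> B \<noteq> {}"
      using polychromatic size assms(2)
      by (intro polychromatic_matching_sum[OF assms(1) _ assms(3,4) colour_mem])
        (simp_all add: k_eq)
    then show ?thesis using polychromatic(2) by (simp add: k_eq)
  next
    case (monochromatic M \<gamma>)
    have "sum c M \<in> B"
      using monochromatic(2,3) assms(2) uniform_matchingD(2,3)[OF monochromatic(1)]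
      by (intro monochromatic_matching_sum[OF maximal(1-3)] colour_mem) (auto simp: k_eq)
    then show ?thesis using matching_sumsI[OF monochromatic(1)] monochromatic(2) k_eq by blast
  qed
qed

text \<open>For a chain \<open>B \<subset> C \<subset> A\<close> with indices \<open>a = [A : C]\<close> and \<open>b = [C : B]\<close>, every set of
  \<open>t = s * a + a - 1\<close> vertices contains \<open>a\<close> disjoint edges with sum in \<open>C\<close>. Colouring the
  \<open>t\<close>-sets by these sums reduces to \<open>C\<close> and \<open>B\<close>, and the vertex counts match:
  \<open>t * b + b - 1 = s * (a * b) + a * b - 1\<close>.\<close>

lemma matching_sums_meet_subgroup:
  fixes A B :: "'g :: {ab_group_add, finite} set" and c :: "'v set \<Rightarrow> 'g"
  assumes "add_subgroup A" "add_subgroup B" "B \<subseteq> A" "card A = k * card B"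
    and "0 < s" "finite V" "s * k + k \<le> card V + 1"
    and "\<And>e. e \<subseteq> V \<Longrightarrow> card e = s \<Longrightarrow> c e \<in> A"
  shows "matching_sums s V k c \<inter> B \<noteq> {}"
  using assms
proof (induction "card A - card B" arbitrary: A B k s V c rule: less_induct)
  case less
  note sub = less.prems(1,2)
  show ?case
  proof (cases "maximal_subgroup B A")
    case True
    then show ?thesis using less.prems(4-) by (rule matching_sums_meet_maximal_subgroup)
  next
    case False
    then obtain C where C: "add_subgroup C" "B \<subset> C" "C \<subset> A"
      using less.prems(1-3) unfolding maximal_subgroup_def by blast
    have "card C dvd card A" "card B dvd card C"
      using card_subgroup_dvd[OF sub(1) C(1)] card_subgroup_dvd[OF C(1) sub(2)] C(2,3) by blast+
    then obtain a b where index_A: "card A = a * card C" and index_C: "card C = b * card B"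
      by (metis dvd_div_mult_self)
    have card_less: "card B < card C" "card C < card A"
      using C(2,3) by (simp_all add: psubset_card_mono)
    have "0 < card B" using add_subgroup.zero_mem[OF sub(2)] by (auto simp: card_gt_0_iff)
    then have k_eq: "k = a * b" using index_A index_C less.prems(4) by auto
    have "0 < a" using index_A card_less by (cases a) auto
    define t where "t = s * a + a - 1"
    have t_eq: "t + 1 = s * a + a" using \<open>0 < a\<close> by (simp add: t_def)
    have "0 < s * a" using \<open>0 < a\<close> less.prems(5) by simp
    then have "0 < t" using t_eq \<open>0 < a\<close> by linarith
    have "t * b + b = s * k + k"
      using arg_cong[OF t_eq, of "\<lambda>x. x * b"] by (simp add: k_eq algebra_simps)
    then have outer: "t * b + b \<le> card V + 1" using less.prems(7) by simp
    show ?thesis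
      unfolding k_eq
    proof (rule matching_sums_compose[OF less.prems(5,6)])
      show "matching_sums s S a c \<inter> C \<noteq> {}" if "S \<subseteq> V" "card S = t" for S
        using C that card_less t_eq less.prems(8) finite_subset[OF that(1) less.prems(6)]
        by (intro less.hyps[OF _ sub(1) C(1) _ index_A less.prems(5)]) auto
      show "matching_sums t V b d \<inter> B \<noteq> {}" if "\<And>S. S \<subseteq> V \<Longrightarrow> card S = t \<Longrightarrow> d S \<in> C" for d
        using C card_less that
        by (intro less.hyps[OF _ C(1) sub(2) _ index_C \<open>0 < t\<close> less.prems(6) outer]) auto
    qed
  qed
qed

theorem zero_sum_matching:
  fixes c :: "'v set \<Rightarrow> 'g :: {ab_group_add, finite}"
  assumes "0 < s" "finite V" "card (UNIV :: 'g set) \<le> m" "group_exponent TYPE('g) dvd m"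
    and "s * m + (card (UNIV :: 'g set) - 1) \<le> card V"
  shows "0 \<in> matching_sums s V m c"
proof -
  let ?n = "card (UNIV :: 'g set)"
  have "0 < ?n" by (simp add: finite_UNIV_card_ge_0)
  have "s * m \<le> card V" using assms(5) by simp
  then obtain N where N: "uniform_matching s V N" "card N = m"
    using ex_uniform_matching[OF assms(2,1)] by blast
  have "group_exponent TYPE('g) dvd m - ?n"
    using assms(4) group_exponent_dvd_card by (rule dvd_diff_nat)
  then obtain J where J: "J \<subseteq> N" "card J = m - ?n" "sum c J = 0"
    using ex_zero_sum_card[OF uniform_matching_finite[OF N(1) assms(2)], of "m - ?n" c]
      N(2) assms(3) by auto
  have mJ: "uniform_matching s V J" using uniform_matching_mono[OF N(1) J(1)] by blast
  have "s * m = s * (m - ?n) + s * ?n" using assms(3) by (simp flip: distrib_left)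
  then have "s * ?n + ?n \<le> card (V - \<Union> J) + 1"
    using card_uncovered[OF mJ assms(2)] J(2) assms(5) \<open>0 < ?n\<close> by simp
  then have "matching_sums s (V - \<Union> J) ?n c \<inter> {0} \<noteq> {}"
    using assms(1,2)
    by (intro matching_sums_meet_subgroup[OF add_subgroup_UNIV add_subgroup_zero]) auto
  then obtain M where M: "uniform_matching s (V - \<Union> J) M" "card M = ?n" "sum c M = 0"
    by (auto elim: matching_sumsE)
  note un = uniform_matching_Un_uncovered[OF mJ M(1) assms(1)]
  have "finite (J \<union> M)" using uniform_matching_finite[OF un(1) assms(2)] .
  then have "card (J \<union> M) = m" "sum c (J \<union> M) = 0"
    using un(2) J(2,3) M(2,3) assms(3) by (simp_all add: card_Un_disjoint sum.union_disjoint)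
  then show ?thesis using matching_sumsI[OF un(1)] by metis
qed

section \<open>Delta-systems\<close>

definition delta_core :: "(nat \<Rightarrow> 'v set) \<Rightarrow> nat \<Rightarrow> 'v set \<Rightarrow> bool" where
  "delta_core e m Q \<longleftrightarrow> finite Q \<and> (\<forall>i\<in>{1..m}. finite (e i) \<and> Q \<subseteq> e i) \<and>
    disjoint_family_on (\<lambda>i. e i - Q) {1..m}"

definition petals :: "(nat \<Rightarrow> 'v set) \<Rightarrow> nat \<Rightarrow> 'v set \<Rightarrow> 'v set" where
  "petals e m Q = (\<Union>i\<in>{1..m}. e i - Q)"

lemma ex_delta_core:
  assumes "delta_system r q m e" "0 < m"
  obtains Q where "delta_core e m Q" "card Q = q"
proof (cases "m = 1")
  case True
  have "finite (e 1)" "q \<le> card (e 1)" using assms by (auto simp: delta_system_def)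
  then obtain Q where "Q \<subseteq> e 1" "card Q = q" "finite Q" by (meson obtain_subset_with_card_n)
  then show ?thesis
    using that[of Q] True \<open>finite (e 1)\<close> by (simp add: delta_core_def disjoint_family_on_def)
next
  case False
  obtain Q where Q: "finite Q" "card Q = q" "\<And>i j. 1 \<le> i \<Longrightarrow> i < j \<Longrightarrow> j \<le> m \<Longrightarrow> e i \<inter> e j = Q"
    using assms(1) unfolding delta_system_def by blast
  have int: "e i \<inter> e j = Q" if "i \<in> {1..m}" "j \<in> {1..m}" "i \<noteq> j" for i j
    using Q(3)[of i j] Q(3)[of j i] that by (cases "i < j") (auto simp: Int_commute)
  have "Q \<subseteq> e i" if "i \<in> {1..m}" for i
  proof -
    have "(if i = 1 then 2 else 1) \<in> {1..m}" "i \<noteq> (if i = 1 then 2 else 1)"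
      using False assms(2) by auto
    then show ?thesis using int[OF that] by blast
  qed
  moreover have "disjoint_family_on (\<lambda>i. e i - Q) {1..m}"
    unfolding disjoint_family_on_def using int by blast
  ultimately show ?thesis
    using that[of Q] Q(1,2) assms(1) by (simp add: delta_core_def delta_system_def)
qed

lemma card_petals:
  assumes "delta_core e m Q" "\<And>i. i \<in> {1..m} \<Longrightarrow> card (e i) = r"
  shows "card (petals e m Q) = (r - card Q) * m"
proof -
  have "card (petals e m Q) = (\<Sum>i\<in>{1..m}. card (e i - Q))"
    using assms(1) unfolding petals_def delta_core_def by (intro card_UN_disjoint') auto
  also have "\<dots> = (\<Sum>i\<in>{1..m}. r - card Q)"
    using assms by (intro sum.cong) (simp_all add: delta_core_def card_Diff_subset)
  finally show ?thesis by simp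
qed

lemma sum_petals:
  fixes w :: "'v \<Rightarrow> 'g :: {ab_group_add, finite}"
  assumes "delta_core e m Q" "group_exponent TYPE('g) dvd m"
  shows "sum w (petals e m Q) = (\<Sum>i=1..m. sum w (e i))"
proof -
  have "sum w (petals e m Q) = (\<Sum>i\<in>{1..m}. sum w (e i - Q))"
    using assms(1) unfolding petals_def delta_core_def by (intro sum.UNION_disjoint_family) auto
  also have "\<dots> = (\<Sum>i\<in>{1..m}. sum w (e i) - sum w Q)"
    using assms(1) by (intro sum.cong) (simp_all add: delta_core_def sum_diff)
  also have "\<dots> = (\<Sum>i=1..m. sum w (e i))" using assms(2) by (intro sum_translate) simp
  finally show ?thesis .
qed

lemma delta_system_of_matching:
  assumes "uniform_matching (r - card Q) V M" "bij_betw \<beta> {1..m} M"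
    and "finite V" "finite Q" "Q \<inter> V = {}" "card Q < r"
  shows "delta_system r (card Q) m (\<lambda>i. Q \<union> \<beta> i)"
proof -
  note M = uniform_matchingD[OF assms(1)]
  have \<beta>: "\<beta> i \<in> M" if "i \<in> {1..m}" for i using bij_betwE[OF assms(2)] that by blast
  have size: "card (Q \<union> \<beta> i) = r" "finite (Q \<union> \<beta> i)" if "i \<in> {1..m}" for i
  proof -
    have "finite (\<beta> i)" using finite_subset[OF M(2)[OF \<beta>[OF that]] assms(3)] .
    moreover have "Q \<inter> \<beta> i = {}" using M(2)[OF \<beta>[OF that]] assms(5) by blast
    ultimately show "card (Q \<union> \<beta> i) = r" "finite (Q \<union> \<beta> i)"
      using M(3)[OF \<beta>[OF that]] assms(4,6) by (simp_all add: card_Un_disjoint)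
  qed
  have int: "(Q \<union> \<beta> i) \<inter> (Q \<union> \<beta> j) = Q" if "i \<in> {1..m}" "j \<in> {1..m}" "i \<noteq> j" for i j
  proof -
    have "\<beta> i \<noteq> \<beta> j" using inj_onD[OF bij_betw_imp_inj_on[OF assms(2)]] that by blast
    then have "\<beta> i \<inter> \<beta> j = {}" using disjointD[OF M(1)] \<beta> that(1,2) by blast
    then show ?thesis by blast
  qed
  have "inj_on (\<lambda>i. Q \<union> \<beta> i) {1..m}"
  proof (rule inj_onI, rule ccontr)
    fix i j assume ij: "i \<in> {1..m}" "j \<in> {1..m}" "Q \<union> \<beta> i = Q \<union> \<beta> j" "i \<noteq> j"
    then have "Q \<union> \<beta> i = Q" using int[OF ij(1,2,4)] by simp
    then show False using size(1)[OF ij(1)] assms(6) by simp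
  qed
  moreover have "\<forall>i j. 1 \<le> i \<and> i < j \<and> j \<le> m \<longrightarrow> (Q \<union> \<beta> i) \<inter> (Q \<union> \<beta> j) = Q" using int by simp
  ultimately show ?thesis
    unfolding delta_system_def using size assms(4,6) by (auto intro!: exI[of _ Q])
qed

section \<open>Bounds for the delta-system Ramsey number\<close>

lemma delta_ramsey_le:
  assumes "q < r" "q < d"
    and "\<And>c :: nat set \<Rightarrow> 'g :: {ab_group_add, finite}. 0 \<in> matching_sums (r - q) {q..<d} m c"
  shows "delta_ramsey r q m TYPE('g) \<le> d"
  unfolding delta_ramsey_def
proof (rule Least_le, intro conjI allI)
  show "0 < d" using assms(2) by simp
  fix c :: "nat set \<Rightarrow> 'g"
  obtain M where M: "uniform_matching (r - q) {q..<d} M" "card M = m" "(\<Sum>f\<in>M. c ({..<q} \<union> f)) = 0"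
    using assms(3) by (rule matching_sumsE)
  have "finite M" using uniform_matching_finite[OF M(1)] by simp
  then obtain \<beta> where \<beta>: "bij_betw \<beta> {1..m} M" using ex_bij_betw_nat_finite_1 M(2) by blast
  let ?e = "\<lambda>i. {..<q} \<union> \<beta> i"
  have delta: "delta_system r q m ?e"
    using delta_system_of_matching[of r "{..<q}" "{q..<d}" M \<beta> m] M(1) \<beta> assms(1)
    by (auto simp: ivl_disj_int)
  have "?e i \<in> complete_edges r d" if i: "i \<in> {1..m}" for i
  proof -
    have "\<beta> i \<subseteq> {q..<d}" using uniform_matchingD(2)[OF M(1)] bij_betwE[OF \<beta>] i by blast
    then show ?thesis using delta i assms(2) by (auto simp: complete_edges_def delta_system_def)
  qed
  moreover have "(\<Sum>i=1..m. c (?e i)) = 0"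
    using sum.reindex_bij_betw[OF \<beta>, of "\<lambda>f. c ({..<q} \<union> f)"] M(3) by simp
  ultimately show "\<exists>e. delta_system r q m e \<and> (\<forall>i\<in>{1..m}. e i \<in> complete_edges r d) \<and>
      (\<Sum>i=1..m. c (e i)) = 0"
    using delta by blast
qed

lemma delta_ramsey_upper_card:
  assumes "q < r" "card (UNIV :: 'g :: {ab_group_add, finite} set) \<le> m"
    and "group_exponent TYPE('g) dvd m"
  shows "delta_ramsey r q m TYPE('g) \<le> (r - q) * m + (card (UNIV :: 'g set) - 1) + q"
proof (rule delta_ramsey_le[OF assms(1)])
  have "0 < m" using assms(2) finite_UNIV_card_ge_0[where ?'a = 'g] by simp
  then show "q < (r - q) * m + (card (UNIV :: 'g set) - 1) + q" using assms(1) by simp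
  show "0 \<in> matching_sums (r - q) {q..<(r - q) * m + (card (UNIV :: 'g set) - 1) + q} m c"
    for c :: "nat set \<Rightarrow> 'g"
    using assms by (intro zero_sum_matching) auto
qed

lemma delta_ramsey_upper_davenport:
  assumes "q < r" "card (UNIV :: 'g :: {ab_group_add, finite} set) \<le> m"
    and "group_exponent TYPE('g) dvd m"
  shows "delta_ramsey r q m TYPE('g) \<le> (r - q) * m + (r - q) * (davenport TYPE('g) - 1) + q"
    (is "_ \<le> ?d")
proof (rule delta_ramsey_le[OF assms(1)])
  have "0 < m" using assms(2) finite_UNIV_card_ge_0[where ?'a = 'g] by simp
  then show "q < ?d" using assms(1) by simp
  fix c :: "nat set \<Rightarrow> 'g"
  have "(r - q) * (m + (davenport TYPE('g) - 1)) \<le> card {q..<?d}" by (simp add: algebra_simps)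
  then obtain N where N: "uniform_matching (r - q) {q..<?d} N"
    "card N = m + (davenport TYPE('g) - 1)"
    using ex_uniform_matching[of "{q..<?d}" "r - q"] assms(1) by auto
  have "finite N" using uniform_matching_finite[OF N(1)] by simp
  moreover have "m + davenport TYPE('g) \<le> card N + 1" using N(2) by linarith
  ultimately obtain M where M: "M \<subseteq> N" "card M = m" "sum c M = 0"
    using gao_zero_sum[of N m c] assms(2,3) by blast
  then show "0 \<in> matching_sums (r - q) {q..<?d} m c"
    using matching_sumsI[OF uniform_matching_mono[OF N(1) M(1) subset_refl]] by metis
qed

lemma delta_ramsey_zero_sum_core:
  assumes "q < r" "0 < m" "group_exponent TYPE('g :: {ab_group_add, finite}) dvd m"
  obtains e Q where "delta_core e m Q" "card Q = q"
    "Q \<union> petals e m Q \<subseteq> {..<delta_ramsey r q m TYPE('g)}"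
    "card (petals e m Q) = (r - q) * m" "(\<Sum>i=1..m. c (e i) :: 'g) = 0"
proof -
  let ?d = "delta_ramsey r q m TYPE('g)"
  have "\<forall>c :: nat set \<Rightarrow> 'g. \<exists>e. delta_system r q m e \<and>
      (\<forall>i\<in>{1..m}. e i \<in> complete_edges r ?d) \<and> (\<Sum>i=1..m. c (e i)) = 0"
    unfolding delta_ramsey_def
    by (rule conjunct2[OF LeastI_ex[OF delta_ramsey_exists[OF assms(1,3)]]])
  then obtain e where e: "delta_system r q m e" "\<forall>i\<in>{1..m}. e i \<in> complete_edges r ?d"
    "(\<Sum>i=1..m. c (e i)) = 0" by meson
  obtain Q where Q: "delta_core e m Q" "card Q = q" using ex_delta_core[OF e(1) assms(2)] .
  have edge: "e i \<subseteq> {..<?d}" "card (e i) = r" if "i \<in> {1..m}" for i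
    using e(2) that by (auto simp: complete_edges_def)
  have "card (petals e m Q) = (r - q) * m" using card_petals[OF Q(1) edge(2)] Q(2) by simp
  moreover have "Q \<subseteq> e 1" using Q(1) assms(2) by (simp add: delta_core_def)
  then have "Q \<union> petals e m Q \<subseteq> {..<?d}" using edge(1) assms(2) by (fastforce simp: petals_def)
  ultimately show ?thesis using that Q e(3) by blast
qed

lemma delta_ramsey_lower_core:
  assumes "q < r" "0 < m" "group_exponent TYPE('g :: {ab_group_add, finite}) dvd m"
  shows "(r - q) * m + q \<le> delta_ramsey r q m TYPE('g)"
proof -
  obtain e Q where Q: "delta_core e m Q" "card Q = q"
    "Q \<union> petals e m Q \<subseteq> {..<delta_ramsey r q m TYPE('g)}" "card (petals e m Q) = (r - q) * m"
    using delta_ramsey_zero_sum_core[OF assms, of "\<lambda>_. 0"] by blast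
  have "finite (petals e m Q)" using Q(3) finite_subset by blast
  moreover have "Q \<inter> petals e m Q = {}" by (auto simp: petals_def)
  ultimately have "card (Q \<union> petals e m Q) = q + (r - q) * m"
    using Q(1,2,4) by (simp add: card_Un_disjoint delta_core_def)
  then show ?thesis using card_mono[OF _ Q(3)] by simp
qed

text \<open>The extremal colouring sums vertex weights: \<open>(r - q) * m - 1\<close> vertices have weight 0, the
  others carry a zero-sum free sequence. The core contributes an \<open>m\<close>-fold multiple, hence nothing,
  and the petals are too large to avoid the weighted vertices.\<close>

lemma delta_ramsey_lower_davenport:
  assumes "q < r" "0 < m" "group_exponent TYPE('g :: {ab_group_add, finite}) dvd m"
  shows "(r - q) * m + (davenport TYPE('g) - 1) \<le> delta_ramsey r q m TYPE('g)"
proof (rule ccontr)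
  let ?d = "delta_ramsey r q m TYPE('g)" and ?D = "davenport TYPE('g)"
  assume too_small: "\<not> ?thesis"
  define z where "z = (r - q) * m - 1"
  have z_less: "z < (r - q) * m" using assms(1,2) by (simp add: z_def)
  have small: "?d \<le> z + (?D - 1)" using too_small by (simp add: z_def)
  obtain s :: "nat \<Rightarrow> 'g" where s: "\<And>I. I \<subseteq> {..<?D - 1} \<Longrightarrow> I \<noteq> {} \<Longrightarrow> sum s I \<noteq> 0"
    using ex_zero_sum_free_davenport by blast
  define w where "w v = (if v < z then 0 else s (v - z))" for v
  obtain e Q where Q: "delta_core e m Q" "Q \<union> petals e m Q \<subseteq> {..<?d}"
    "card (petals e m Q) = (r - q) * m" "(\<Sum>i=1..m. sum w (e i)) = 0"
    using delta_ramsey_zero_sum_core[OF assms, of "sum w"] by blast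
  define heavy where "heavy = petals e m Q - {..<z}"
  have fin: "finite (petals e m Q)" using Q(2) finite_subset by blast
  have "inj_on (\<lambda>v. v - z) heavy" by (auto simp: heavy_def intro!: inj_onI)
  then have "sum s ((\<lambda>v. v - z) ` heavy) = sum w heavy" by (simp add: sum.reindex w_def heavy_def)
  also have "\<dots> = sum w (petals e m Q)"
    using fin by (intro sum.mono_neutral_left) (auto simp: w_def heavy_def)
  also have "\<dots> = 0" using sum_petals[OF Q(1) assms(3), of w] Q(4) by simp
  finally have "sum s ((\<lambda>v. v - z) ` heavy) = 0" .
  moreover have "(\<lambda>v. v - z) ` heavy \<subseteq> {..<?D - 1}" using Q(2) small by (fastforce simp: heavy_def)
  moreover have "\<not> petals e m Q \<subseteq> {..<z}"
    using card_mono[of "{..<z}" "petals e m Q"] Q(3) z_less by auto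
  then have "(\<lambda>v. v - z) ` heavy \<noteq> {}" by (simp add: heavy_def)
  ultimately show False using s by blast
qed

theorem theorem1p2:
  fixes r q m :: nat
  assumes "q < r"
    and "card (UNIV :: 'g :: {ab_group_add, finite} set) \<le> m"
    and "group_exponent TYPE('g) dvd m"
  shows "(r - q) * m + max q (davenport TYPE('g) - 1) \<le> delta_ramsey r q m TYPE('g)
    \<and> delta_ramsey r q m TYPE('g)
        \<le> (r - q) * m + min ((r - q) * (davenport TYPE('g) - 1)) (card (UNIV :: 'g set) - 1) + q"
proof
  have "0 < m" using assms(2) finite_UNIV_card_ge_0[where ?'a = 'g] by simp
  then show "(r - q) * m + max q (davenport TYPE('g) - 1) \<le> delta_ramsey r q m TYPE('g)"
    using delta_ramsey_lower_core[OF assms(1) _ assms(3)]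
      delta_ramsey_lower_davenport[OF assms(1) _ assms(3)] by (simp add: max_def)
  show "delta_ramsey r q m TYPE('g)
      \<le> (r - q) * m + min ((r - q) * (davenport TYPE('g) - 1)) (card (UNIV :: 'g set) - 1) + q"
    using delta_ramsey_upper_davenport[OF assms] delta_ramsey_upper_card[OF assms]
    by (simp add: min_def)
qed

end
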